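(* Let $X=Y$ be a Polish space, let $c:X\times Y\to(-\infty,\infty]$ be a continuous and symmetric cost function which is essentially bounded from below with respect to Borel probability measures $\mu\in\mathcal P(X)$ and $\nu\in\mathcal P(Y)$. Assume that $\mu$ and $\nu$ are strongly $c$-compatible, i.e. they are $c$-compatible and for every measurable $A\subset X$ with $0<\mu(A)<1$ we have $$\mu(A)+\nu(\{y\in Y:\ \forall x\in A,\ c(x,y)=\infty\})<1.$$ If there exists some finite cost plan transporting $\mu$ to $\nu$, then there exist a $c$-class function $\varphi$ and an optimal transport plan $\pi\in\Pi(\mu,\nu)$ concentrated on $\partial^c\varphi$.
   Context: $\mathcal P(X)$ denotes the Borel probability measures on $X$. Symmetric means $c(x,y)=c(y,x)$. Continuity is with respect to the usual topology of $(-\infty,\infty]$. Essentially bounded from below with respect to $\mu,\nu$: there exist $a\in L^1(\mu)$, $b\in L^1(\nu)$ with $c(x,y)\ge a(x)+b(y)$ for all $x,y$. $\mu$ and $\nu$ are $c$-compatible if for every measurable $A\subset X$, $\mu(A)+\nu(\{y\in Y:\ \forall x\in A,\ c(x,y)=\infty\})\le 1$. $\Pi(\mu,\nu)$ is the set of transport plans: probability measures $\pi$ on $X\times Y$ with marginals $\mu$ and $\nu$. The cost of $\pi$ is $\int_{X\times Y}c\,d\pi$; $\pi$ is a finite cost plan if its cost is $<+\infty$, and it is optimal if it attains $C(\mu,\nu)=\inf_{\pi\in\Pi(\mu,\nu)}\int c\,d\pi$. The $c$-transform of $\psi:Y\to[-\infty,\infty]$ is $\psi^c(x)=\inf_{y}(c(x,y)-\psi(y))$,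 with the convention $\infty-\infty=+\infty$; similarly $\varphi^c(y)=\inf_x(c(x,y)-\varphi(x))$. The $c$-class is $\{\psi^c:\ \psi:Y\to[-\infty,\infty]\}$ (equivalently, functions with $\varphi^{cc}=\varphi$). For $\varphi$ in the $c$-class, $$\partial^c\varphi=\{(x,y)\in X\times Y:\ \varphi(x)+\varphi^c(y)=c(x,y)\ \text{and}\ c(x,y)<\infty\}.$$ *)

theory Defs
  imports "HOL-Probability.Probability"
begin

text \<open>Costs with values in the extended reals are integrated as the integral of the positive part
  minus that of the negative part; \<^const>\<open>e2ennreal\<close> sends negative values to 0. For the costs and
  plans considered below the integral of the negative part is finite (essential boundedness from
  below), so that the difference is meaningful.\<close>

definition ereal_integral :: "'a measure \<Rightarrow> ('a \<Rightarrow> ereal) \<Rightarrow> ereal" where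
  "ereal_integral M f =
     enn2ereal (\<integral>\<^sup>+ z. e2ennreal (f z) \<partial>M) - enn2ereal (\<integral>\<^sup>+ z. e2ennreal (- f z) \<partial>M)"

definition ess_bounded_below :: "('a \<Rightarrow> 'b \<Rightarrow> ereal) \<Rightarrow> 'a measure \<Rightarrow> 'b measure \<Rightarrow> bool" where
  "ess_bounded_below c \<mu> \<nu> \<longleftrightarrow>
     (\<exists>(a :: 'a \<Rightarrow> real) (b :: 'b \<Rightarrow> real). integrable \<mu> a \<and> integrable \<nu> b \<and>
        (\<forall>x y. ereal (a x + b y) \<le> c x y))"

text \<open>For a continuous cost and Borel measures, the set of all \<open>y\<close> with \<open>c x y = \<infinity>\<close> for every
  \<open>x \<in> A\<close> is closed, hence \<^const>\<open>measure\<close> is applied to a measurable set.\<close>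

definition c_compatible :: "('a \<Rightarrow> 'b \<Rightarrow> ereal) \<Rightarrow> 'a measure \<Rightarrow> 'b measure \<Rightarrow> bool" where
  "c_compatible c \<mu> \<nu> \<longleftrightarrow>
     (\<forall>A \<in> sets \<mu>. measure \<mu> A + measure \<nu> {y. \<forall>x\<in>A. c x y = \<infinity>} \<le> 1)"

definition strongly_c_compatible :: "('a \<Rightarrow> 'b \<Rightarrow> ereal) \<Rightarrow> 'a measure \<Rightarrow> 'b measure \<Rightarrow> bool" where
  "strongly_c_compatible c \<mu> \<nu> \<longleftrightarrow>
     c_compatible c \<mu> \<nu> \<and>
     (\<forall>A \<in> sets \<mu>. 0 < measure \<mu> A \<and> measure \<mu> A < 1 \<longrightarrow>
        measure \<mu> A + measure \<nu> {y. \<forall>x\<in>A. c x y = \<infinity>} < 1)"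

definition transport_plans ::
    "'a::topological_space measure \<Rightarrow> 'b::topological_space measure \<Rightarrow> ('a \<times> 'b) measure set" where
  "transport_plans \<mu> \<nu> =
     {\<pi>. prob_space \<pi> \<and> sets \<pi> = sets borel \<and> distr \<pi> borel fst = \<mu> \<and> distr \<pi> borel snd = \<nu>}"

definition plan_cost :: "('a \<Rightarrow> 'b \<Rightarrow> ereal) \<Rightarrow> ('a \<times> 'b) measure \<Rightarrow> ereal" where
  "plan_cost c \<pi> = ereal_integral \<pi> (\<lambda>(x, y). c x y)"

definition total_cost ::
    "('a::topological_space \<Rightarrow> 'b::topological_space \<Rightarrow> ereal) \<Rightarrow> 'a measure \<Rightarrow> 'b measure \<Rightarrow> ereal" where
  "total_cost c \<mu> \<nu> = (INF \<pi> \<in> transport_plans \<mu> \<nu>. plan_cost c \<pi>)"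

definition optimal_plan ::
    "('a::topological_space \<Rightarrow> 'b::topological_space \<Rightarrow> ereal) \<Rightarrow> 'a measure \<Rightarrow> 'b measure \<Rightarrow>
     ('a \<times> 'b) measure \<Rightarrow> bool" where
  "optimal_plan c \<mu> \<nu> \<pi> \<longleftrightarrow> \<pi> \<in> transport_plans \<mu> \<nu> \<and> plan_cost c \<pi> = total_cost c \<mu> \<nu>"

text \<open>The transforms use the convention \<open>\<infinity> - \<infinity> = \<infinity>\<close>, which is the one of \<^typ>\<open>ereal\<close>.\<close>

lemma ereal_infinity_minus_infinity: "(\<infinity>::ereal) - \<infinity> = \<infinity>"
  by simp

text \<open>The first transform takes functions on the second factor to functions on the first one,
  the second transform goes the other way.\<close>

definition c_transform :: "('a \<Rightarrow> 'b \<Rightarrow> ereal) \<Rightarrow> ('b \<Rightarrow> ereal) \<Rightarrow> 'a \<Rightarrow> ereal" where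
  "c_transform c \<psi> x = (INF y. c x y - \<psi> y)"

definition c_transform' :: "('a \<Rightarrow> 'b \<Rightarrow> ereal) \<Rightarrow> ('a \<Rightarrow> ereal) \<Rightarrow> 'b \<Rightarrow> ereal" where
  "c_transform' c \<phi> y = (INF x. c x y - \<phi> x)"

definition c_class :: "('a \<Rightarrow> 'b \<Rightarrow> ereal) \<Rightarrow> ('a \<Rightarrow> ereal) set" where
  "c_class c = range (c_transform c)"

definition c_subgradient :: "('a \<Rightarrow> 'b \<Rightarrow> ereal) \<Rightarrow> ('a \<Rightarrow> ereal) \<Rightarrow> ('a \<times> 'b) set" where
  "c_subgradient c \<phi> = {(x, y). \<phi> x + c_transform' c \<phi> y = c x y \<and> c x y < \<infinity>}"

definition concentrated_on :: "'a measure \<Rightarrow> 'a set \<Rightarrow> bool" where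
  "concentrated_on M S \<longleftrightarrow> (AE z in M. z \<in> S)"

end

theory Submission
  imports Defs
begin

text \<open>
An optimal plan exists by the direct method: plans with given marginals are compact because the
marginals on a Polish space are tight (\<open>transport_plans_cluster_point\<close>), and the cost functional
is lower semicontinuous because the cost minus its integrable lower bound is a countable supremum of
multiples of indicators of measurable rectangles (\<open>nn_integral_le_limit\<close>,
\<open>cost_excess_eq_SUP_rectangles\<close>).

For a plan \<open>\<pi>\<close> of finite and minimal cost, let \<open>G\<close> be the part of its topological support on which the
cost is finite; it carries all the mass. Since the cost is continuous, exchanging partners near a finite
cycle of points of \<open>G\<close> cannot reduce the cost, so \<open>G\<close> is cyclically monotone
(\<open>optimal_plan_cyclically_monotone\<close>). For a cost with infinite values this alone does not give a
potential: the infimum over chains that defines Rockafellar's potential may be infinite. Strong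
compatibility removes this obstruction. It makes \<open>G\<close> connected: any two points are joined by a
chain of finite cost in either direction (\<open>support_connected_by_finite_chains\<close>). Chains to a point
then make the potential less than \<open>\<infinity>\<close>, and chains back, together with cyclical monotonicity, make it
greater than \<open>-\<infinity>\<close> (\<open>potential_of_connected_cyclically_monotone\<close>).
\<close>

section \<open>Compactness of the set of transport plans\<close>

text \<open>By Tychonoff's theorem the cube \<open>[0,1]\<close> indexed by all sets is compact, so every sequence of
probability measures has a cluster point there. A filter that realises the cluster point gives limits
on all sets simultaneously, which a subsequence would do only for countably many sets.\<close>

lemma set_function_cluster_point:
  fixes P :: "nat \<Rightarrow> 'a measure"
  assumes P: "\<And>n. prob_space (P n)"
  obtains G \<beta> where "G \<noteq> bot" "G \<le> sequentially"
    "\<And>S. ((\<lambda>n. measure (P n) S) \<longlongrightarrow> \<beta> S) G"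
proof -
  define m where "m = (\<lambda>n S. measure (P n) S)"
  define K where "K = (PiE UNIV (\<lambda>_. {0..1}) :: ('a set \<Rightarrow> real) set)"
  have "compactin (product_topology (\<lambda>_. euclidean) UNIV) K"
    unfolding K_def by (simp add: compactin_PiE)
  then have "compact K"
    by (simp add: euclidean_product_topology)
  moreover have "filtermap m sequentially \<noteq> bot"
    by (simp add: filtermap_bot_iff)
  moreover have "eventually (\<lambda>f. f \<in> K) (filtermap m sequentially)"
    unfolding eventually_filtermap K_def m_def
    by (auto intro!: always_eventually prob_space.prob_le_1[OF P])
  ultimately obtain \<beta> where \<beta>: "inf (nhds \<beta>) (filtermap m sequentially) \<noteq> bot"
    unfolding compact_filter by blast
  define G where "G = inf (filtercomap m (nhds \<beta>)) sequentially"
  have "G \<noteq> bot"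
  proof
    assume "G = bot"
    then have "eventually (\<lambda>_. False) G" by simp
    then obtain Q R where Q: "eventually Q (nhds \<beta>)" and R: "eventually R sequentially"
      and QR: "\<And>n. Q (m n) \<Longrightarrow> R n \<Longrightarrow> False"
      unfolding G_def eventually_inf eventually_filtercomap by blast
    have "eventually (\<lambda>f. \<exists>n. R n \<and> f = m n) (filtermap m sequentially)"
      unfolding eventually_filtermap using R by (rule eventually_mono) auto
    with Q have "eventually (\<lambda>_. False) (inf (nhds \<beta>) (filtermap m sequentially))"
      unfolding eventually_inf using QR by blast
    with \<beta> show False by (simp add: trivial_limit_def)
  qed
  moreover have "G \<le> sequentially"
    by (simp add: G_def)
  moreover have "((\<lambda>n. measure (P n) S) \<longlongrightarrow> \<beta> S) G" for S
  proof -
    have m: "filterlim m (nhds \<beta>) G"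
      unfolding G_def by (rule filterlim_mono[OF filterlim_filtercomap]) auto
    have "((\<lambda>n. m n S) \<longlongrightarrow> \<beta> S) G"
    proof (rule topological_tendstoI)
      fix U assume "open U" "\<beta> S \<in> U"
      moreover have "open ((\<lambda>f. f S) -` U)"
        by (rule open_vimage[OF \<open>open U\<close>]) simp
      ultimately have "eventually (\<lambda>f. f \<in> (\<lambda>f. f S) -` U) (nhds \<beta>)"
        by (intro eventually_nhds_in_open) auto
      then show "eventually (\<lambda>n. m n S \<in> U) G"
        using m by (auto simp: filterlim_iff)
    qed
    then show ?thesis by (simp add: m_def)
  qed
  ultimately show thesis by (rule that)
qed

lemma inner_regular_compact:
  fixes M :: "'a::polish_space measure"
  assumes "prob_space M" "sets M = sets borel" "A \<in> sets borel" "0 < e"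
  obtains K where "compact K" "K \<subseteq> A" "measure M (A - K) < e"
proof -
  interpret prob_space M by fact
  note [measurable_cong] = assms(2)
  have A: "emeasure M A = (SUP K \<in> {K. K \<subseteq> A \<and> compact K}. emeasure M K)"
    using assms by (intro inner_regular) (auto simp: emeasure_eq_measure)
  obtain K where K: "K \<subseteq> A" "compact K" and le: "measure M A < measure M K + e"
  proof (cases "measure M A < e")
    case True
    show thesis by (rule that[of "{}"]) (use True in auto)
  next
    case False
    have "ennreal (measure M A - e) < emeasure M A"
      unfolding emeasure_eq_measure using False \<open>0 < e\<close> by (intro ennreal_lessI) auto
    then obtain K where "K \<subseteq> A" "compact K" "ennreal (measure M A - e) < emeasure M K"
      unfolding A less_SUP_iff by auto
    then show thesis
      using False \<open>0 < e\<close> by (intro that[of K]) (auto simp: emeasure_eq_measure ennreal_less_iff)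
  qed
  have "K \<in> sets M"
    using K by (auto simp: assms(2) intro: borel_closed compact_imp_closed)
  then have "measure M (A - K) = measure M A - measure M K"
    using K assms by (intro finite_measure_Diff) auto
  with le K show thesis by (intro that[of K]) auto
qed

lemma transport_plansD:
  assumes "\<pi> \<in> transport_plans \<mu> \<nu>"
  shows "prob_space \<pi>" "sets \<pi> = sets borel" "space \<pi> = UNIV"
    "distr \<pi> borel fst = \<mu>" "distr \<pi> borel snd = \<nu>"
  using assms sets_eq_imp_space_eq[of \<pi> borel] by (auto simp: transport_plans_def)

lemma measure_plan_marginals:
  fixes \<mu> :: "'a::second_countable_topology measure" and \<nu> :: "'b::second_countable_topology measure"
  assumes "\<pi> \<in> transport_plans \<mu> \<nu>"
  shows "A \<in> sets borel \<Longrightarrow> measure \<pi> (A \<times> UNIV) = measure \<mu> A"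
    and "B \<in> sets borel \<Longrightarrow> measure \<pi> (UNIV \<times> B) = measure \<nu> B"
proof -
  note D = transport_plansD[OF assms]
  have [measurable]: "fst \<in> borel_measurable \<pi>" "snd \<in> borel_measurable \<pi>"
    by (auto simp: measurable_cong_sets[OF D(2) refl] borel_prod[symmetric])
  have fst: "fst -` A = A \<times> UNIV" and snd: "snd -` B = UNIV \<times> B" for A :: "'a set" and B :: "'b set"
    by auto
  show "A \<in> sets borel \<Longrightarrow> measure \<pi> (A \<times> UNIV) = measure \<mu> A"
    unfolding D(4)[symmetric] by (subst measure_distr) (auto simp: D(3) fst)
  show "B \<in> sets borel \<Longrightarrow> measure \<pi> (UNIV \<times> B) = measure \<nu> B"
    unfolding D(5)[symmetric] by (subst measure_distr) (auto simp: D(3) snd)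
qed

lemma transport_planI:
  fixes \<mu> :: "'a::second_countable_topology measure" and \<nu> :: "'b::second_countable_topology measure"
  assumes "prob_space \<mu>" "prob_space \<nu>" "sets \<mu> = sets borel" "sets \<nu> = sets borel"
    and \<pi>: "sets \<pi> = sets borel"
    and fst: "\<And>A. A \<in> sets borel \<Longrightarrow> emeasure \<pi> (A \<times> UNIV) = emeasure \<mu> A"
    and snd: "\<And>B. B \<in> sets borel \<Longrightarrow> emeasure \<pi> (UNIV \<times> B) = emeasure \<nu> B"
  shows "\<pi> \<in> transport_plans \<mu> \<nu>"
proof -
  have sp: "space \<pi> = UNIV" "space \<mu> = UNIV"
    using sets_eq_imp_space_eq[OF \<pi>] sets_eq_imp_space_eq[OF assms(3)] by auto
  have [measurable]: "fst \<in> borel_measurable \<pi>" "snd \<in> borel_measurable \<pi>"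
    by (auto simp: measurable_cong_sets[OF \<pi> refl] borel_prod[symmetric])
  have *: "fst -` A = A \<times> UNIV" "snd -` B = UNIV \<times> B" for A :: "'a set" and B :: "'b set"
    by auto
  have "distr \<pi> borel fst = \<mu>" "distr \<pi> borel snd = \<nu>"
    using assms by (auto intro!: measure_eqI simp: emeasure_distr sp * fst snd)
  moreover have "prob_space \<pi>"
    using fst[of UNIV] prob_space.emeasure_space_1[OF assms(1)] by (intro prob_spaceI) (simp add: sp)
  ultimately show ?thesis
    using \<pi> by (simp add: transport_plans_def)
qed

text \<open>Cluster points of plans are again plans, in the sense of convergence along a filter on an algebra
containing all measurable rectangles. The set function \<open>\<beta>\<close> obtained as a limit is only finitely
additive. Its marginals are the countably additive measures \<open>\<mu>\<close> and \<open>\<nu>\<close>, and these are tight; hence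
\<open>\<beta>\<close> approximates every measurable rectangle, and the complement of every measurable rectangle, from
inside by compact sets. The sets with this approximation property form an algebra on which \<open>\<beta>\<close> is
continuous at the empty set, because finitely many of the approximating compact sets already have
empty intersection. Caratheodory's theorem then yields the limit plan. It agrees with \<open>\<beta>\<close> on the
algebra, though perhaps not on other Borel sets.\<close>

lemma transport_plans_cluster_point:
  fixes \<mu> :: "'a::polish_space measure" and \<nu> :: "'b::polish_space measure"
  assumes \<mu>: "prob_space \<mu>" "sets \<mu> = sets borel"
    and \<nu>: "prob_space \<nu>" "sets \<nu> = sets borel"
    and P: "\<And>n::nat. P n \<in> transport_plans \<mu> \<nu>"
  obtains G \<pi> \<A> where "G \<noteq> bot" "G \<le> sequentially" "\<pi> \<in> transport_plans \<mu> \<nu>"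
    "algebra UNIV \<A>" "\<A> \<subseteq> sets borel"
    "\<And>A B. A \<in> sets borel \<Longrightarrow> B \<in> sets borel \<Longrightarrow> A \<times> B \<in> \<A>"
    "\<And>S. S \<in> \<A> \<Longrightarrow> ((\<lambda>n. measure (P n) S) \<longlongrightarrow> measure \<pi> S) G"
proof -
  note D = transport_plansD[OF P]
  obtain G \<beta> where G: "G \<noteq> bot" "G \<le> sequentially"
    and lim: "\<And>S. ((\<lambda>n. measure (P n) S) \<longlongrightarrow> \<beta> S) G"
    using set_function_cluster_point[of P] D(1) by blast
  interpret P: prob_space "P n" for n by (rule D)
  have rect: "A \<times> B \<in> sets borel" if "A \<in> sets borel" "B \<in> sets borel" for A :: "'a set" and B :: "'b set"
    using that by (simp add: borel_prod[symmetric])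
  have nonneg: "0 \<le> \<beta> S" for S
    by (rule tendsto_lowerbound[OF lim _ G(1)]) simp
  have add: "\<beta> (S \<union> T) = \<beta> S + \<beta> T" if "S \<in> sets borel" "T \<in> sets borel" "S \<inter> T = {}" for S T
  proof (rule tendsto_unique[OF G(1) lim])
    have "measure (P n) (S \<union> T) = measure (P n) S + measure (P n) T" for n
      using that by (intro P.finite_measure_Union) (auto simp: D)
    then show "((\<lambda>n. measure (P n) (S \<union> T)) \<longlongrightarrow> \<beta> S + \<beta> T) G"
      using tendsto_add[OF lim lim] by simp
  qed
  have mono: "\<beta> S \<le> \<beta> T" if "S \<subseteq> T" "T \<in> sets borel" for S T
    by (rule tendsto_le[OF G(1) lim lim])
       (use that in \<open>auto intro!: always_eventually P.finite_measure_mono simp: D\<close>)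
  have subadd: "\<beta> (S \<union> T) \<le> \<beta> S + \<beta> T" if "S \<in> sets borel" "T \<in> sets borel" for S T
    by (rule tendsto_le[OF G(1) tendsto_add[OF lim lim] lim])
       (use that in \<open>auto intro!: always_eventually measure_Un_le simp: D\<close>)
  have const: "\<beta> S = r" if "\<And>n. measure (P n) S = r" for S r
    using tendsto_unique[OF G(1) lim[of S], of r] that by simp
  have m1: "\<beta> (A \<times> UNIV) = measure \<mu> A" if "A \<in> sets borel" for A
    by (rule const) (rule measure_plan_marginals(1)[OF P that])
  have m2: "\<beta> (UNIV \<times> B) = measure \<nu> B" if "B \<in> sets borel" for B
    by (rule const) (rule measure_plan_marginals(2)[OF P that])

  define inner where "inner S \<longleftrightarrow> (\<forall>e>0. \<exists>K. compact K \<and> K \<subseteq> S \<and> \<beta> (S - K) < e)" for S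
  have innerE: "\<exists>K. compact K \<and> K \<subseteq> S \<and> K \<in> sets borel \<and> \<beta> (S - K) < e" if "inner S" "0 < e" for S e
    using that unfolding inner_def by (meson borel_closed compact_imp_closed)
  have inner_Un: "inner (S \<union> T)" if S: "inner S" "S \<in> sets borel" and T: "inner T" "T \<in> sets borel" for S T
    unfolding inner_def
  proof (intro allI impI)
    fix e :: real assume "0 < e"
    obtain K L where KL: "compact K" "K \<subseteq> S" "\<beta> (S - K) < e/2" "compact L" "L \<subseteq> T" "\<beta> (T - L) < e/2"
        "K \<in> sets borel" "L \<in> sets borel"
      using innerE[OF S(1), of "e/2"] innerE[OF T(1), of "e/2"] \<open>0 < e\<close> by auto
    have "\<beta> ((S \<union> T) - (K \<union> L)) \<le> \<beta> ((S - K) \<union> (T - L))"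
      using S T KL by (intro mono) auto
    also have "\<dots> \<le> \<beta> (S - K) + \<beta> (T - L)"
      using S T KL by (intro subadd) auto
    finally show "\<exists>K. compact K \<and> K \<subseteq> S \<union> T \<and> \<beta> ((S \<union> T) - K) < e"
      using KL by (intro exI[of _ "K \<union> L"]) (auto simp: compact_Un)
  qed
  have inner_Int: "inner (S \<inter> T)" if S: "inner S" "S \<in> sets borel" and T: "inner T" "T \<in> sets borel" for S T
    unfolding inner_def
  proof (intro allI impI)
    fix e :: real assume "0 < e"
    obtain K L where KL: "compact K" "K \<subseteq> S" "\<beta> (S - K) < e/2" "compact L" "L \<subseteq> T" "\<beta> (T - L) < e/2"
        "K \<in> sets borel" "L \<in> sets borel"
      using innerE[OF S(1), of "e/2"] innerE[OF T(1), of "e/2"] \<open>0 < e\<close> by auto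
    have "\<beta> ((S \<inter> T) - (K \<inter> L)) \<le> \<beta> ((S - K) \<union> (T - L))"
      using S T KL by (intro mono) auto
    also have "\<dots> \<le> \<beta> (S - K) + \<beta> (T - L)"
      using S T KL by (intro subadd) auto
    finally show "\<exists>K. compact K \<and> K \<subseteq> S \<inter> T \<and> \<beta> ((S \<inter> T) - K) < e"
      using KL by (intro exI[of _ "K \<inter> L"]) (auto simp: compact_Int)
  qed
  have inner_rect: "inner (A \<times> B)" if A: "A \<in> sets borel" and B: "B \<in> sets borel" for A B
    unfolding inner_def
  proof (intro allI impI)
    fix e :: real assume "0 < e"
    then have e2: "0 < e/2" by simp
    obtain K where K: "compact K" "K \<subseteq> A" "measure \<mu> (A - K) < e/2"
      by (rule inner_regular_compact[OF \<mu> A e2])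
    obtain L where L: "compact L" "L \<subseteq> B" "measure \<nu> (B - L) < e/2"
      by (rule inner_regular_compact[OF \<nu> B e2])
    have [simp]: "K \<in> sets borel" "L \<in> sets borel"
      using K L by (auto intro: borel_closed compact_imp_closed)
    have "\<beta> (A \<times> B - K \<times> L) \<le> \<beta> ((A - K) \<times> UNIV \<union> UNIV \<times> (B - L))"
      using A B by (intro mono sets.Un rect) auto
    also have "\<dots> \<le> \<beta> ((A - K) \<times> UNIV) + \<beta> (UNIV \<times> (B - L))"
      using A B by (intro subadd rect) auto
    also have "\<beta> ((A - K) \<times> UNIV) = measure \<mu> (A - K)"
      using A by (intro m1) auto
    also have "\<beta> (UNIV \<times> (B - L)) = measure \<nu> (B - L)"
      using B by (intro m2) auto
    finally show "\<exists>K. compact K \<and> K \<subseteq> A \<times> B \<and> \<beta> (A \<times> B - K) < e"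
      using K L A B by (intro exI[of _ "K \<times> L"]) (auto simp: compact_Times)
  qed

  \<comment> \<open>Requiring the approximation for the complement as well makes this family an algebra.\<close>
  define \<A> where "\<A> = {S \<in> sets borel. inner S \<and> inner (- S)}"
  have \<A>_borel: "\<A> \<subseteq> sets borel"
    by (auto simp: \<A>_def)
  have rect_\<A>: "A \<times> B \<in> \<A>" if "A \<in> sets borel" "B \<in> sets borel" for A B
  proof -
    have "- (A \<times> B) = (- A) \<times> UNIV \<union> UNIV \<times> (- B)" by auto
    then show ?thesis
      using that by (auto simp: \<A>_def intro!: rect inner_rect inner_Un)
  qed
  have alg: "algebra UNIV \<A>"
    unfolding algebra_iff_Int
  proof (intro conjI ballI)
    show "{} \<in> \<A>" using rect_\<A>[of "{}" "{}"] by simp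
    show "UNIV - S \<in> \<A>" if "S \<in> \<A>" for S
      using that by (auto simp: \<A>_def Compl_eq_Diff_UNIV[symmetric])
    show "S \<inter> T \<in> \<A>" if "S \<in> \<A>" "T \<in> \<A>" for S T
      using that by (auto simp: \<A>_def intro!: inner_Int inner_Un)
  qed auto
  interpret alg: algebra UNIV \<A> by (rule alg)
  have "\<exists>p. (\<forall>S\<in>\<A>. p S = ennreal (\<beta> S)) \<and> measure_space UNIV (sigma_sets UNIV \<A>) p"
  proof (rule alg.caratheodory_empty_continuous)
    show "positive \<A> (\<lambda>S. ennreal (\<beta> S))"
      using const[of "{}" 0] by (simp add: positive_def)
    show "additive \<A> (\<lambda>S. ennreal (\<beta> S))"
      unfolding additive_def using add nonneg \<A>_borel by (auto simp: ennreal_plus[symmetric] simp del: ennreal_plus)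
    fix A :: "nat \<Rightarrow> ('a \<times> 'b) set"
    assume A: "range A \<subseteq> \<A>" and dec: "decseq A" and emp: "(\<Inter>i. A i) = {}"
    have "(\<lambda>i. \<beta> (A i)) \<longlonglongrightarrow> 0"
    proof (rule LIMSEQ_I)
      fix e :: real assume "0 < e"
      \<comment> \<open>The errors \<open>e / 2 ^ (i + 1)\<close> add up to less than \<open>e\<close>.\<close>
      have "\<exists>K. compact K \<and> K \<subseteq> A i \<and> K \<in> sets borel \<and> \<beta> (A i - K) < e / 2 ^ (Suc i)" for i
        using A \<open>0 < e\<close> by (intro innerE) (auto simp: \<A>_def)
      then obtain K where K: "\<And>i. compact (K i)" "\<And>i. K i \<subseteq> A i" "\<And>i. K i \<in> sets borel"
          and less: "\<And>i. \<beta> (A i - K i) < e / 2 ^ (Suc i)"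
        by metis
      have "\<exists>I. finite I \<and> K 0 \<inter> (\<Inter>i\<in>I. K i) = {}"
      proof (rule ccontr)
        assume *: "\<not> (\<exists>I. finite I \<and> K 0 \<inter> (\<Inter>i\<in>I. K i) = {})"
        have "K 0 \<inter> (\<Inter>i\<in>UNIV. K i) \<noteq> {}"
        proof (rule compact_imp_fip_image[OF K(1)])
          show "closed (K i)" for i
            by (rule compact_imp_closed) (rule K(1))
          show "K 0 \<inter> (\<Inter>i\<in>I. K i) \<noteq> {}" if "finite I" for I
            using * that by metis
        qed
        moreover have "(\<Inter>i. K i) \<subseteq> (\<Inter>i. A i)"
          using K(2) by (rule INF_mono')
        ultimately show False
          unfolding emp by (metis Int_empty_right subset_empty)
      qed
      then obtain I where I: "finite I" "K 0 \<inter> (\<Inter>i\<in>I. K i) = {}" by blast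
      define N where "N = Max (insert 0 I)"
      have IN: "insert 0 I \<subseteq> {..N}"
        using I(1) by (auto simp: N_def)
      have A_borel [simp]: "A i \<in> sets borel" for i
        using A \<A>_borel by auto
      have "\<beta> (\<Union>i\<le>n. A i - K i) \<le> (\<Sum>i\<le>n. \<beta> (A i - K i))" for n
      proof (induction n)
        case (Suc n)
        have "\<beta> ((A (Suc n) - K (Suc n)) \<union> (\<Union>i\<le>n. A i - K i)) \<le>
            \<beta> (A (Suc n) - K (Suc n)) + \<beta> (\<Union>i\<le>n. A i - K i)"
          using K(3) by (intro subadd sets.finite_UN) auto
        with Suc show ?case by (simp add: atMost_Suc)
      qed simp
      then have "\<beta> (\<Union>i\<le>N. A i - K i) \<le> (\<Sum>i\<le>N. \<beta> (A i - K i))" .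
      also have "\<dots> \<le> (\<Sum>i\<le>N. e / 2 ^ (Suc i))"
        by (intro sum_mono less_imp_le less)
      also have "(\<Sum>i\<le>n. e / 2 ^ (Suc i)) = e - e / 2 ^ (Suc n)" for n
        by (induction n) (auto simp: field_simps)
      also have "e - e / 2 ^ (Suc N) < e"
        using \<open>0 < e\<close> by simp
      finally have *: "\<beta> (\<Union>i\<le>N. A i - K i) < e" .
      have "\<bar>\<beta> (A n)\<bar> < e" if "N \<le> n" for n
      proof -
        \<comment> \<open>The compact sets up to index \<open>N\<close> have empty intersection, so each point of \<open>A n\<close> misses one of them.\<close>
        have "A n \<subseteq> (\<Union>i\<le>N. A i - K i)"
        proof
          fix z assume z: "z \<in> A n"
          obtain i where i: "i \<le> N" "z \<notin> K i"
            using I(2) IN by blast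
          have "z \<in> A i"
            using z decseqD[OF dec, of i n] i that by auto
          with i show "z \<in> (\<Union>i\<le>N. A i - K i)" by auto
        qed
        then have "\<beta> (A n) \<le> \<beta> (\<Union>i\<le>N. A i - K i)"
          using K(3) by (intro mono sets.finite_UN) auto
        with * nonneg[of "A n"] show ?thesis by simp
      qed
      then show "\<exists>N. \<forall>n\<ge>N. norm (\<beta> (A n) - 0) < e"
        by auto
    qed
    then show "(\<lambda>i. ennreal (\<beta> (A i))) \<longlonglongrightarrow> 0"
      by (metis ennreal_0 tendsto_ennrealI)
  qed simp
  then obtain p where p: "\<And>S. S \<in> \<A> \<Longrightarrow> p S = ennreal (\<beta> S)" and ms: "measure_space UNIV (sigma_sets UNIV \<A>) p"
    by blast
  have \<A>_gen: "sigma_sets UNIV \<A> = sets borel"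
  proof
    show "sigma_sets UNIV \<A> \<subseteq> sets borel"
      using sets.sigma_sets_subset[of \<A> borel] \<A>_borel by simp
    have "sets (borel :: ('a \<times> 'b) measure) = sigma_sets UNIV {a \<times> b | a b. a \<in> sets borel \<and> b \<in> sets borel}"
      by (simp add: borel_prod[symmetric] sets_pair_measure)
    also have "\<dots> \<subseteq> sigma_sets UNIV \<A>"
      using rect_\<A> by (intro sigma_sets_mono') auto
    finally show "sets borel \<subseteq> sigma_sets UNIV \<A>" .
  qed
  define \<pi> where "\<pi> = measure_of UNIV (sigma_sets UNIV \<A>) p"
  have sets_\<pi>: "sets \<pi> = sets borel"
    unfolding \<pi>_def \<A>_gen by (metis sets.sets_measure_of_eq space_borel)
  have em: "emeasure \<pi> S = ennreal (\<beta> S)" if "S \<in> \<A>" for S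
    unfolding \<pi>_def
    using ms that p by (subst emeasure_measure_of_sigma) (auto simp: measure_space_def)
  have \<pi>: "\<pi> \<in> transport_plans \<mu> \<nu>"
  proof (rule transport_planI)
    show "emeasure \<pi> (A \<times> UNIV) = emeasure \<mu> A" if "A \<in> sets borel" for A
      using that em[OF rect_\<A>[OF that, of UNIV]]
        finite_measure.emeasure_eq_measure[OF prob_space.finite_measure[OF \<mu>(1)]] by (simp add: m1)
    show "emeasure \<pi> (UNIV \<times> B) = emeasure \<nu> B" if "B \<in> sets borel" for B
      using that em[OF rect_\<A>[OF _ that, of UNIV]]
        finite_measure.emeasure_eq_measure[OF prob_space.finite_measure[OF \<nu>(1)]] by (simp add: m2)
  qed (use assms sets_\<pi> in auto)
  have "measure \<pi> S = \<beta> S" if "S \<in> \<A>" for S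
    using em[OF that] nonneg by (simp add: measure_def)
  then show thesis
    using lim by (intro that[OF G \<pi> alg \<A>_borel rect_\<A>]) auto
qed

section \<open>Existence of an optimal plan\<close>

text \<open>Lower semicontinuity of the integral for convergence on an algebra. The partial suprema \<open>s k\<close> are simple
functions all of whose level sets lie in the algebra, so their integrals converge; the monotone
convergence theorem passes from \<open>s k\<close> to \<open>f\<close>, at the price of an inequality.\<close>

lemma nn_integral_le_limit:
  fixes f :: "'a \<Rightarrow> ennreal" and P :: "nat \<Rightarrow> 'a measure"
  assumes "algebra UNIV \<A>"
    and M: "prob_space M" "\<A> \<subseteq> sets M" "space M = UNIV"
    and P: "\<And>n. prob_space (P n)" "\<And>n. \<A> \<subseteq> sets (P n)" "\<And>n. space (P n) = UNIV"
    and f: "\<And>z. f z = (SUP i. v i * indicator (S i) z)"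
    and v: "\<And>i::nat. v i < \<infinity>" and S: "\<And>i. S i \<in> \<A>"
    and lim: "\<And>S. S \<in> \<A> \<Longrightarrow> ((\<lambda>n. measure (P n) S) \<longlongrightarrow> measure M S) G"
    and conv: "((\<lambda>n. \<integral>\<^sup>+z. f z \<partial>P n) \<longlongrightarrow> l) G" and "G \<noteq> bot"
  shows "(\<integral>\<^sup>+z. f z \<partial>M) \<le> l"
proof -
  interpret algebra UNIV \<A> by fact
  define s where "s k z = (SUP i\<in>{..k}. v i * indicator (S i) z)" for k z
  have s0: "s 0 z = v 0 * indicator (S 0) z" for z
    by (simp add: s_def)
  have sSuc: "s (Suc k) z = sup (s k z) (v (Suc k) * indicator (S (Suc k)) z)" for k z
    by (simp add: s_def atMost_Suc sup_commute)
  have [simp]: "sup x 0 = x" for x :: ennreal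
    by (simp add: sup_absorb1)
  have level: "{z. Q (s k z)} \<in> \<A>" for Q k
  proof (induction k arbitrary: Q)
    case 0
    have "{z. Q (s 0 z)} = (S 0 \<inter> {z. Q (v 0)}) \<union> ((UNIV - S 0) \<inter> {z. Q 0})"
      by (auto simp: s0 indicator_def)
    also have "\<dots> \<in> \<A>"
      using S by (intro Un Int compl_sets) auto
    finally show ?case .
  next
    case (Suc k)
    have "{z. Q (s (Suc k) z)} = (S (Suc k) \<inter> {z. Q (sup (s k z) (v (Suc k)))}) \<union>
        ((UNIV - S (Suc k)) \<inter> {z. Q (s k z)})"
      by (auto simp: sSuc indicator_def)
    also have "\<dots> \<in> \<A>"
      using S by (intro Un Int compl_sets Suc) auto
    finally show ?case .
  qed
  have fin: "finite (range (s k))" for k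
  proof (induction k)
    case 0
    have "range (s 0) \<subseteq> {0, v 0}"
      by (auto simp: s0 indicator_def)
    then show ?case by (rule finite_subset) simp
  next
    case (Suc k)
    have "range (s (Suc k)) \<subseteq> range (s k) \<union> (\<lambda>x. sup x (v (Suc k))) ` range (s k)"
      by (auto simp: sSuc split: split_indicator)
    then show ?case by (rule finite_subset) (simp add: Suc)
  qed
  have less_top: "s k z < \<infinity>" for k z
    by (induction k) (auto simp: s0 sSuc v[simplified] sup_max split: split_indicator)
  have int: "(\<integral>\<^sup>+z. s k z \<partial>N) = (\<Sum>x\<in>range (s k). x * ennreal (measure N {z. s k z = x}))"
    if N: "prob_space N" "\<A> \<subseteq> sets N" "space N = UNIV" for N k
  proof -
    interpret N: prob_space N by fact
    have *: "s k -` {x} = {z. s k z = x}" for x by auto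
    have "simple_function N (s k)"
      unfolding simple_function_def N(3) using fin level[of "\<lambda>y. y = _"] N(2) by (auto simp: *)
    then have "(\<integral>\<^sup>+z. s k z \<partial>N) = integral\<^sup>S N (s k)"
      by (rule nn_integral_eq_simple_integral)
    then show ?thesis
      by (simp add: simple_integral_def N(3) * N.emeasure_eq_measure)
  qed
  have le: "(\<integral>\<^sup>+z. s k z \<partial>M) \<le> l" for k
  proof (rule tendsto_le[OF \<open>G \<noteq> bot\<close> conv])
    show "((\<lambda>n. \<integral>\<^sup>+z. s k z \<partial>P n) \<longlongrightarrow> (\<integral>\<^sup>+z. s k z \<partial>M)) G"
      unfolding int[OF P] int[OF M] using less_top
      by (intro tendsto_sum ennreal_tendsto_cmult tendsto_ennrealI lim level) auto
    show "eventually (\<lambda>n. (\<integral>\<^sup>+z. s k z \<partial>P n) \<le> (\<integral>\<^sup>+z. f z \<partial>P n)) G"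
      by (auto intro!: always_eventually nn_integral_mono simp: f s_def intro: SUP_subset_mono)
  qed
  have meas: "s k \<in> borel_measurable M" for k
  proof -
    have "simple_function M (s k)"
      unfolding simple_function_def M(3)
      using fin level[of "\<lambda>y. y = _"] M(2) by (auto simp: vimage_def)
    then show ?thesis by (rule borel_measurable_simple_function)
  qed
  have "f z = (SUP k. s k z)" for z
    unfolding f s_def
  proof (rule antisym)
    show "(SUP i. v i * indicator (S i) z) \<le> (SUP k. SUP i\<in>{..k}. v i * indicator (S i) z)"
      by (rule SUP_mono) (auto intro!: SUP_upper)
    show "(SUP k. SUP i\<in>{..k}. v i * indicator (S i) z) \<le> (SUP i. v i * indicator (S i) z)"
      by (intro SUP_least SUP_upper) auto
  qed
  then have "(\<integral>\<^sup>+z. f z \<partial>M) = (\<integral>\<^sup>+z. (SUP k. s k z) \<partial>M)"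
    by simp
  also have "\<dots> = (SUP k. \<integral>\<^sup>+z. s k z \<partial>M)"
  proof (rule nn_integral_monotone_convergence_SUP)
    show "incseq s"
      by (auto simp: incseq_Suc_iff le_fun_def sSuc)
  qed (rule meas)
  also have "\<dots> \<le> l"
    by (intro SUP_least le)
  finally show ?thesis .
qed

text \<open>Subtracting the integrable lower bound makes the cost nonnegative. By the marginal constraints this
changes the cost of every plan by the same finite amount. Where the lower bound holds, the difference
is nonnegative and \<open>e2ennreal\<close> does not truncate it.\<close>

definition cost_excess :: "('a \<Rightarrow> 'b \<Rightarrow> ereal) \<Rightarrow> ('a \<Rightarrow> real) \<Rightarrow> ('b \<Rightarrow> real) \<Rightarrow> 'a \<times> 'b \<Rightarrow> ennreal" where
  "cost_excess c a b = (\<lambda>(x, y). e2ennreal (c x y - ereal (a x + b y)))"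

text \<open>This is what makes the semicontinuity lemma applicable although \<open>a\<close> and \<open>b\<close> are merely measurable:
the continuous cost exceeds a rational \<open>r\<close> on a countable union of basic open rectangles, and the
conditions \<open>s < - a x\<close> and \<open>t < - b y\<close> cut out measurable rectangles, so each rectangle carries the
constant lower bound \<open>r + s + t\<close>.\<close>

lemma cost_excess_eq_SUP_rectangles:
  fixes c :: "'a::second_countable_topology \<Rightarrow> 'b::second_countable_topology \<Rightarrow> ereal"
  assumes c: "continuous_on UNIV (\<lambda>(x, y). c x y)"
    and [measurable]: "a \<in> borel_measurable borel" "b \<in> borel_measurable borel"
  obtains v :: "nat \<Rightarrow> ennreal" and A B where "\<And>i. v i < \<infinity>" "\<And>i. A i \<in> sets borel" "\<And>i. B i \<in> sets borel"
    "\<And>z. cost_excess c a b z = (SUP i. v i * indicator (A i \<times> B i) z)"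
proof -
  obtain BA :: "'a set set" where BA: "countable BA" "topological_basis BA"
    using ex_countable_basis by blast
  obtain BB :: "'b set set" where BB: "countable BB" "topological_basis BB"
    using ex_countable_basis by blast
  have "BA \<noteq> {}" "BB \<noteq> {}"
    using topological_basisE[OF BA(2) open_UNIV UNIV_I] topological_basisE[OF BB(2) open_UNIV UNIV_I] by auto
  define I where "I = BA \<times> BB \<times> (UNIV :: (rat \<times> rat \<times> rat) set)"
  have I: "countable I" "I \<noteq> {}"
    using BA BB \<open>BA \<noteq> {}\<close> \<open>BB \<noteq> {}\<close> by (auto simp: I_def)
  define v where "v = (\<lambda>(U, V, r, s, t). if \<forall>x\<in>U. \<forall>y\<in>V. ereal (of_rat r) < c x y
      then ennreal (of_rat r + of_rat s + of_rat t) else 0)"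
  define A where "A = (\<lambda>(U :: 'a set, V :: 'b set, r :: rat, s, t :: rat). {x \<in> U. of_rat s < - a x})"
  define B where "B = (\<lambda>(U :: 'a set, V, r :: rat, s :: rat, t). {y \<in> V. of_rat t < - b y})"
  have "cost_excess c a b z = (SUP i\<in>I. v i * indicator (A i \<times> B i) z)" for z
  proof (rule antisym)
    obtain x y where z: "z = (x, y)" by force
    show "(SUP i\<in>I. v i * indicator (A i \<times> B i) z) \<le> cost_excess c a b z"
    proof (rule SUP_least)
      fix i assume "i \<in> I"
      obtain U V r s t where i: "i = (U, V, r, s, t)" by (cases i)
      show "v i * indicator (A i \<times> B i) z \<le> cost_excess c a b z"
      proof (cases "z \<in> A i \<times> B i \<and> v i \<noteq> 0")
        case True
        then have "ereal (of_rat r) < c x y" and st: "of_rat s < - a x" "of_rat t < - b y"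
          by (auto simp: z i A_def B_def v_def split: if_splits)
        then have "ereal (of_rat r) - ereal (a x + b y) \<le> c x y - ereal (a x + b y)"
          by (intro ereal_minus_mono) auto
        moreover have "ereal (of_rat r + of_rat s + of_rat t) \<le> ereal (of_rat r) - ereal (a x + b y)"
          using st by simp
        ultimately have "e2ennreal (ereal (of_rat r + of_rat s + of_rat t)) \<le> e2ennreal (c x y - ereal (a x + b y))"
          by (intro e2ennreal_mono) (rule order_trans)
        then show ?thesis
          using True by (auto simp: z i v_def cost_excess_def ennreal.abs_eq[symmetric] split: if_splits)
      next
        case False
        then show ?thesis by (auto split: split_indicator)
      qed
    qed
    show "cost_excess c a b z \<le> (SUP i\<in>I. v i * indicator (A i \<times> B i) z)"
    proof (rule dense_le)
      fix w assume w: "w < cost_excess c a b z"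
      then obtain q where q: "w = ennreal q" "0 \<le> q"
        by (cases w) auto
      have "e2ennreal (ereal q) < e2ennreal (c x y - ereal (a x + b y))"
        using w by (simp add: q z cost_excess_def)
      then have "ereal q < c x y - ereal (a x + b y)"
        using e2ennreal_mono[of "c x y - ereal (a x + b y)" "ereal q"] by (auto simp: not_le[symmetric])
      then have "ereal (q + a x + b y) < c x y"
        by (cases "c x y") auto
      then obtain \<rho> where \<rho>: "q + a x + b y < \<rho>" "ereal \<rho> < c x y"
        using ereal_dense2 by fastforce
      obtain r where r: "q + a x + b y < of_rat r" "of_rat r < \<rho>"
        using of_rat_dense[OF \<rho>(1)] by blast
      \<comment> \<open>Rationals \<open>s\<close> and \<open>t\<close> within \<open>d / 2\<close> of \<open>- a x\<close> and \<open>- b y\<close> cost at most the margin \<open>d\<close> gained in \<open>r\<close>.\<close>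
      define d where "d = of_rat r - (q + a x + b y)"
      have d: "0 < d" using r by (simp add: d_def)
      obtain s where s: "- a x - d / 2 < of_rat s" "of_rat s < - a x"
        using of_rat_dense[of "- a x - d / 2" "- a x"] d by auto
      obtain t where t: "- b y - d / 2 < of_rat t" "of_rat t < - b y"
        using of_rat_dense[of "- b y - d / 2" "- b y"] d by auto
      have "open ((\<lambda>(x, y). c x y) -` {ereal (of_rat r)<..})"
        using c by (intro open_vimage) auto
      moreover have "(x, y) \<in> (\<lambda>(x, y). c x y) -` {ereal (of_rat r)<..}"
        using r \<rho> by (auto intro: order.strict_trans[of _ "ereal \<rho>"])
      ultimately obtain U0 V0 where 0: "open U0" "open V0" "(x, y) \<in> U0 \<times> V0"
          "U0 \<times> V0 \<subseteq> (\<lambda>(x, y). c x y) -` {ereal (of_rat r)<..}"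
        by (rule open_prod_elim)
      obtain U where U: "U \<in> BA" "x \<in> U" "U \<subseteq> U0"
        using topological_basisE[OF BA(2) 0(1), of x] 0(3) by auto
      obtain V where V: "V \<in> BB" "y \<in> V" "V \<subseteq> V0"
        using topological_basisE[OF BB(2) 0(2), of y] 0(3) by auto
      let ?i = "(U, V, r, s, t)"
      have "ereal (of_rat r) < c x' y'" if "x' \<in> U" "y' \<in> V" for x' y'
      proof -
        have "(x', y') \<in> (\<lambda>(x, y). c x y) -` {ereal (of_rat r)<..}"
          by (rule subsetD[OF 0(4)]) (use U(3) V(3) that in auto)
        then show ?thesis by simp
      qed
      then have "v ?i = ennreal (of_rat r + of_rat s + of_rat t)"
        by (simp add: v_def)
      moreover have "q \<le> of_rat r + of_rat s + of_rat t"
        using s t by (simp add: d_def field_simps)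
      moreover have "z \<in> A ?i \<times> B ?i"
        using U V s t by (simp add: A_def B_def z)
      ultimately have "w \<le> v ?i * indicator (A ?i \<times> B ?i) z"
        by (simp add: q ennreal_leI)
      also have "\<dots> \<le> (SUP i\<in>I. v i * indicator (A i \<times> B i) z)"
        using U V by (intro SUP_upper) (simp add: I_def)
      finally show "w \<le> (SUP i\<in>I. v i * indicator (A i \<times> B i) z)" .
    qed
  qed
  moreover have "(SUP i\<in>I. g i) = (SUP n. g (from_nat_into I n))" for g :: "_ \<Rightarrow> ennreal"
    using range_from_nat_into[OF I(2,1)] by (metis image_image)
  ultimately have eq: "cost_excess c a b z = (SUP n. v (from_nat_into I n) *
      indicator (A (from_nat_into I n) \<times> B (from_nat_into I n)) z)" for z
    by simp
  show thesis
  proof (rule that[OF _ _ _ eq])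
    fix n
    obtain U V r s t where i: "from_nat_into I n = (U, V, r, s, t)" by (cases "from_nat_into I n")
    then have "U \<in> BA" "V \<in> BB"
      using from_nat_into[OF I(2), of n] by (auto simp: I_def)
    then have [measurable]: "U \<in> sets borel" "V \<in> sets borel"
      using BA BB by (auto intro: borel_open topological_basis_open)
    show "v (from_nat_into I n) < \<infinity>"
      by (simp add: i v_def)
    show "A (from_nat_into I n) \<in> sets borel" "B (from_nat_into I n) \<in> sets borel"
      by (simp_all add: i A_def B_def)
  qed
qed

text \<open>The integral of \<open>f\<^sup>+\<close> may be infinite, so linearity of the integral is replaced
by the pointwise identity \<open>f\<^sup>+ + h\<^sup>- = (f - h) + f\<^sup>- + h\<^sup>+\<close> between nonnegative functions, in which
\<open>f\<^sup>-\<close>, \<open>h\<^sup>+\<close> and \<open>h\<^sup>-\<close> have finite integrals.\<close>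

lemma ereal_integral_eq_excess:
  assumes [measurable]: "f \<in> borel_measurable M" and h: "integrable M h" and le: "\<And>z. ereal (h z) \<le> f z"
  shows "ereal_integral M f = enn2ereal (\<integral>\<^sup>+z. e2ennreal (f z - ereal (h z)) \<partial>M) + ereal (\<integral>z. h z \<partial>M)"
proof -
  have [measurable]: "h \<in> borel_measurable M" using h by simp
  let ?D = "\<integral>\<^sup>+z. e2ennreal (f z - ereal (h z)) \<partial>M"
  let ?P = "\<integral>\<^sup>+z. e2ennreal (f z) \<partial>M" and ?N = "\<integral>\<^sup>+z. e2ennreal (- f z) \<partial>M"
  let ?p = "\<integral>\<^sup>+z. ennreal (h z) \<partial>M" and ?n = "\<integral>\<^sup>+z. ennreal (- h z) \<partial>M"
  have fin: "?p < \<infinity>" "?n < \<infinity>"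
    using h by (auto simp: real_integrable_def less_top)
  have "?N \<le> ?n"
  proof (rule nn_integral_mono)
    fix z
    have "e2ennreal (- f z) \<le> e2ennreal (- ereal (h z))"
      using le by (intro e2ennreal_mono) (simp only: ereal_minus_le_minus)
    then show "e2ennreal (- f z) \<le> ennreal (- h z)" by (simp add: ennreal.abs_eq)
  qed
  with fin have fN: "?N < \<infinity>" by (metis order_le_less_trans)
  have eq: "e2ennreal (f z) + ennreal (- h z) = e2ennreal (f z - ereal (h z)) + (e2ennreal (- f z) + ennreal (h z))" for z
  proof (cases "f z")
    case (real r)
    with le[of z] have "h z \<le> r" by simp
    then have "ennreal r + ennreal (- h z) = ennreal (r - h z) + (ennreal (- r) + ennreal (h z))"
      by (cases "0 \<le> r"; cases "0 \<le> h z") (auto simp: ennreal_neg ennreal_plus[symmetric] simp del: ennreal_plus)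
    then show ?thesis by (simp add: real)
  next
    case PInf
    then show ?thesis by simp
  next
    case MInf
    with le[of z] show ?thesis by simp
  qed
  have sum: "?P + ?n = ?D + (?N + ?p)"
  proof -
    have "?P + ?n = (\<integral>\<^sup>+z. e2ennreal (f z) + ennreal (- h z) \<partial>M)"
      by (rule nn_integral_add[symmetric]) auto
    also have "\<dots> = ?D + (\<integral>\<^sup>+z. e2ennreal (- f z) + ennreal (h z) \<partial>M)"
      unfolding eq by (rule nn_integral_add) auto
    also have "(\<integral>\<^sup>+z. e2ennreal (- f z) + ennreal (h z) \<partial>M) = ?N + ?p"
      by (rule nn_integral_add) auto
    finally show ?thesis .
  qed
  obtain p where p: "?p = ennreal p" "0 \<le> p"
    using fin(1) by (cases ?p) auto
  obtain n where n: "?n = ennreal n" "0 \<le> n"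
    using fin(2) by (cases ?n) auto
  obtain N where N: "?N = ennreal N" "0 \<le> N"
    using fN by (cases ?N) auto
  have int: "(\<integral>z. h z \<partial>M) = p - n"
    unfolding real_lebesgue_integral_def[OF h] using p n by simp
  show ?thesis
  proof (cases ?D)
    case (real d)
    have "?P + ennreal n = ennreal (d + (N + p))"
      using sum unfolding real p n N using real(1) p(2) N(2) by simp
    moreover from this obtain q where q: "?P = ennreal q" "0 \<le> q"
      by (cases ?P) auto
    ultimately have "q + n = d + (N + p)"
      using real(1) p(2) N(2) n(2) by (simp add: ennreal_plus[symmetric] del: ennreal_plus)
    then show ?thesis
      unfolding ereal_integral_def real q N int using q(2) N(2) real(1) by simp
  next
    case top
    have "?P + ennreal n = \<infinity>"
      using sum unfolding top n by simp
    then have "?P = \<infinity>"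
      by (cases ?P) auto
    then show ?thesis
      unfolding ereal_integral_def top N using N(2) by simp
  qed
qed

lemma integrable_marginal_sum:
  fixes \<pi> :: "('a::second_countable_topology \<times> 'b::second_countable_topology) measure"
  assumes a: "integrable \<mu> a" and b: "integrable \<nu> b" and \<pi>: "\<pi> \<in> transport_plans \<mu> \<nu>"
  shows "integrable \<pi> (\<lambda>z. a (fst z) + b (snd z) :: real)"
    and "(\<integral>z. a (fst z) + b (snd z) \<partial>\<pi>) = (\<integral>x. a x \<partial>\<mu>) + (\<integral>y. b y \<partial>\<nu>)"
proof -
  note D = transport_plansD[OF \<pi>]
  have [measurable]: "fst \<in> borel_measurable \<pi>" "snd \<in> borel_measurable \<pi>"
    by (auto simp: measurable_cong_sets[OF D(2) refl] borel_prod[symmetric])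
  have "a \<in> borel_measurable \<mu>" "b \<in> borel_measurable \<nu>"
    using a b by auto
  then have [measurable]: "a \<in> borel_measurable borel" "b \<in> borel_measurable borel"
    by (simp_all add: D(4,5)[symmetric])
  have ia: "integrable \<pi> (\<lambda>z. a (fst z))" and Ia: "(\<integral>z. a (fst z) \<partial>\<pi>) = (\<integral>x. a x \<partial>\<mu>)"
    using a unfolding D(4)[symmetric] by (simp_all add: integrable_distr_eq integral_distr)
  have ib: "integrable \<pi> (\<lambda>z. b (snd z))" and Ib: "(\<integral>z. b (snd z) \<partial>\<pi>) = (\<integral>y. b y \<partial>\<nu>)"
    using b unfolding D(5)[symmetric] by (simp_all add: integrable_distr_eq integral_distr)
  show "integrable \<pi> (\<lambda>z. a (fst z) + b (snd z))"
    "(\<integral>z. a (fst z) + b (snd z) \<partial>\<pi>) = (\<integral>x. a x \<partial>\<mu>) + (\<integral>y. b y \<partial>\<nu>)"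
    using ia ib Ia Ib by simp_all
qed

lemma plan_cost_eq_excess:
  fixes c :: "'a::polish_space \<Rightarrow> 'b::polish_space \<Rightarrow> ereal"
  assumes c: "continuous_on UNIV (\<lambda>(x, y). c x y)"
    and a: "integrable \<mu> a" and b: "integrable \<nu> b" and le: "\<And>x y. ereal (a x + b y) \<le> c x y"
    and \<pi>: "\<pi> \<in> transport_plans \<mu> \<nu>"
  shows "plan_cost c \<pi> = enn2ereal (\<integral>\<^sup>+z. cost_excess c a b z \<partial>\<pi>) + ereal ((\<integral>x. a x \<partial>\<mu>) + (\<integral>y. b y \<partial>\<nu>))"
proof -
  note ab = integrable_marginal_sum[OF a b \<pi>]
  have "(\<lambda>(x, y). c x y) \<in> borel_measurable \<pi>"
    using borel_measurable_continuous_onI[OF c]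
    by (simp add: measurable_cong_sets[OF transport_plansD(2)[OF \<pi>] refl])
  then have "plan_cost c \<pi> = enn2ereal (\<integral>\<^sup>+z. e2ennreal ((\<lambda>(x, y). c x y) z - ereal (a (fst z) + b (snd z))) \<partial>\<pi>)
      + ereal (\<integral>z. a (fst z) + b (snd z) \<partial>\<pi>)"
    unfolding plan_cost_def using ab(1) le by (intro ereal_integral_eq_excess) auto
  then show ?thesis
    by (simp add: ab(2) cost_excess_def split_beta)
qed

lemma finite_cost_integrable:
  fixes c :: "'a::polish_space \<Rightarrow> 'b::polish_space \<Rightarrow> ereal"
  assumes c: "continuous_on UNIV (\<lambda>(x, y). c x y)"
    and a: "integrable \<mu> a" and b: "integrable \<nu> b" and le: "\<And>x y. ereal (a x + b y) \<le> c x y"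
    and \<pi>: "\<pi> \<in> transport_plans \<mu> \<nu>" and cost: "plan_cost c \<pi> < \<infinity>"
  shows "AE (x, y) in \<pi>. c x y < \<infinity>" "integrable \<pi> (\<lambda>(x, y). real_of_ereal (c x y))"
proof -
  note D = transport_plansD[OF \<pi>]
  note [measurable_cong] = D(2)
  note ab = integrable_marginal_sum[OF a b \<pi>]
  have [measurable]: "(\<lambda>z. c (fst z) (snd z)) \<in> borel_measurable borel"
    using borel_measurable_continuous_onI[OF c] by (simp add: split_beta')
  have [measurable]: "(\<lambda>z. a (fst z) + b (snd z)) \<in> borel_measurable \<pi>"
    using ab(1) by (rule borel_measurable_integrable)
  have [measurable]: "cost_excess c a b \<in> borel_measurable \<pi>"
    by (simp add: cost_excess_def split_beta')
  have J: "(\<integral>\<^sup>+z. cost_excess c a b z \<partial>\<pi>) \<noteq> \<infinity>"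
    using cost unfolding plan_cost_eq_excess[OF c a b le \<pi>] by auto
  then have "AE z in \<pi>. cost_excess c a b z \<noteq> \<infinity>"
    by (intro nn_integral_PInf_AE) auto
  then have fin: "AE z in \<pi>. c (fst z) (snd z) < \<infinity>"
    by eventually_elim (auto simp: cost_excess_def split_beta')
  then show "AE (x, y) in \<pi>. c x y < \<infinity>"
    by (simp add: split_beta')
  have "integrable \<pi> (\<lambda>z. enn2real (cost_excess c a b z))"
  proof (rule integrableI_nonneg)
    have "(\<integral>\<^sup>+z. ennreal (enn2real (cost_excess c a b z)) \<partial>\<pi>) \<le> (\<integral>\<^sup>+z. cost_excess c a b z \<partial>\<pi>)"
      by (intro nn_integral_mono) (simp add: ennreal_enn2real_if)
    also have "\<dots> < \<infinity>"
      using J by (simp add: less_top)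
    finally show "(\<integral>\<^sup>+z. ennreal (enn2real (cost_excess c a b z)) \<partial>\<pi>) < \<infinity>" .
  qed auto
  then have i: "integrable \<pi> (\<lambda>z. enn2real (cost_excess c a b z) + (a (fst z) + b (snd z)))"
    using ab(1) by (rule Bochner_Integration.integrable_add)
  have ae: "AE z in \<pi>. enn2real (cost_excess c a b z) + (a (fst z) + b (snd z)) = real_of_ereal (c (fst z) (snd z))"
    using fin
  proof eventually_elim
    case (elim z)
    with le[of "fst z" "snd z"] show ?case
      by (cases "c (fst z) (snd z)") (auto simp: cost_excess_def split_beta')
  qed
  have "integrable \<pi> (\<lambda>z. real_of_ereal (c (fst z) (snd z)))"
    by (rule integrable_cong_AE_imp[OF i _ ae]) measurable
  then show "integrable \<pi> (\<lambda>(x, y). real_of_ereal (c x y))"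
    by (simp add: split_beta')
qed

text \<open>The direct method: any cluster point of a sequence of plans that minimises the integral of the excess
is optimal by semicontinuity.\<close>

theorem optimal_plan_exists:
  fixes c :: "'a::polish_space \<Rightarrow> 'b::polish_space \<Rightarrow> ereal"
  assumes \<mu>: "prob_space \<mu>" "sets \<mu> = sets borel"
    and \<nu>: "prob_space \<nu>" "sets \<nu> = sets borel"
    and c: "continuous_on UNIV (\<lambda>(x, y). c x y)"
    and bd: "ess_bounded_below c \<mu> \<nu>"
    and ne: "transport_plans \<mu> \<nu> \<noteq> {}"
  obtains \<pi> where "optimal_plan c \<mu> \<nu> \<pi>"
proof -
  obtain a b where a: "integrable \<mu> a" and b: "integrable \<nu> b" and le: "\<And>x y. ereal (a x + b y) \<le> c x y"
    using bd unfolding ess_bounded_below_def by blast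
  define J where "J \<pi> = (\<integral>\<^sup>+z. cost_excess c a b z \<partial>\<pi>)" for \<pi>
  have "a \<in> borel_measurable \<mu>" "b \<in> borel_measurable \<nu>"
    using a b by auto
  then have "a \<in> borel_measurable borel" "b \<in> borel_measurable borel"
    by (simp_all add: measurable_cong_sets[OF \<mu>(2) refl] measurable_cong_sets[OF \<nu>(2) refl])
  then obtain v :: "nat \<Rightarrow> ennreal" and A B where v: "\<And>i. v i < \<infinity>"
    and AB: "\<And>i. A i \<in> sets borel" "\<And>i. B i \<in> sets borel"
    and sup: "\<And>z. cost_excess c a b z = (SUP i. v i * indicator (A i \<times> B i) z)"
    using cost_excess_eq_SUP_rectangles[OF c] by blast
  obtain f where f: "decseq f" "range f \<subseteq> J ` transport_plans \<mu> \<nu>"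
    and inf: "Inf (J ` transport_plans \<mu> \<nu>) = (INF n. f n)"
    using ennreal_Inf_countable_INF[of "J ` transport_plans \<mu> \<nu>"] ne by auto
  have "\<exists>\<pi>. \<pi> \<in> transport_plans \<mu> \<nu> \<and> J \<pi> = f n" for n
    using f(2) by (metis (no_types, lifting) imageE range_subsetD)
  then obtain P where P: "\<And>n. P n \<in> transport_plans \<mu> \<nu>" "\<And>n. J (P n) = f n"
    by metis
  obtain G \<pi> \<A> where G: "G \<noteq> bot" "G \<le> sequentially" and \<pi>: "\<pi> \<in> transport_plans \<mu> \<nu>"
    and \<A>: "algebra UNIV \<A>" "\<A> \<subseteq> sets borel"
      "\<And>A B. A \<in> sets borel \<Longrightarrow> B \<in> sets borel \<Longrightarrow> A \<times> B \<in> \<A>"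
    and lim: "\<And>S. S \<in> \<A> \<Longrightarrow> ((\<lambda>n. measure (P n) S) \<longlongrightarrow> measure \<pi> S) G"
    using transport_plans_cluster_point[OF \<mu> \<nu>, of P] P(1) by blast
  have "J \<pi> \<le> Inf (J ` transport_plans \<mu> \<nu>)"
    unfolding J_def
  proof (rule nn_integral_le_limit[OF \<A>(1) _ _ _ _ _ _ sup v _ lim _ G(1)])
    have "f \<longlonglongrightarrow> (INF n. f n)"
      using f(1) by (rule LIMSEQ_INF)
    then show "((\<lambda>n. \<integral>\<^sup>+z. cost_excess c a b z \<partial>P n) \<longlongrightarrow> Inf ((\<lambda>\<pi>. \<integral>\<^sup>+z. cost_excess c a b z \<partial>\<pi>) ` transport_plans \<mu> \<nu>)) G"
      using tendsto_mono[OF G(2)] inf by (simp add: J_def[symmetric] P(2))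
  qed (use transport_plansD[OF \<pi>] transport_plansD[OF P(1)] \<A> AB in auto)
  then have le_J: "J \<pi> \<le> J \<pi>'" if "\<pi>' \<in> transport_plans \<mu> \<nu>" for \<pi>'
    using that by (meson INF_lower2 order.trans order_refl)
  have "plan_cost c \<pi> \<le> plan_cost c \<pi>'" if "\<pi>' \<in> transport_plans \<mu> \<nu>" for \<pi>'
    using le_J[OF that] unfolding plan_cost_eq_excess[OF c a b le \<pi>] plan_cost_eq_excess[OF c a b le that] J_def
    by (intro add_right_mono) (simp add: less_eq_ennreal.rep_eq)
  then have "plan_cost c \<pi> = total_cost c \<mu> \<nu>"
    unfolding total_cost_def using \<pi> by (intro antisym INF_greatest INF_lower)
  then show thesis
    using \<pi> by (intro that) (simp add: optimal_plan_def)
qed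

section \<open>Rearranging mass within the marginal constraints\<close>

lemma measure_sum_exists:
  assumes "sets N = sets M"
  obtains S where "sets S = sets M"
    "\<And>f. f \<in> borel_measurable M \<Longrightarrow> (\<integral>\<^sup>+z. f z \<partial>S) = (\<integral>\<^sup>+z. f z \<partial>M) + (\<integral>\<^sup>+z. f z \<partial>N)"
proof -
  define S where "S = measure_of (space M) (sets M) (\<lambda>A. emeasure M A + emeasure N A)"
  have sets [measurable_cong]: "sets S = sets M"
    by (simp add: S_def)
  have em: "emeasure S A = emeasure M A + emeasure N A" if "A \<in> sets M" for A
    unfolding S_def
  proof (rule emeasure_measure_of_sigma)
    show "sigma_algebra (space M) (sets M)"
      by (rule sets.sigma_algebra_axioms)
    show "countably_additive (sets M) (\<lambda>A. emeasure M A + emeasure N A)"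
    proof (rule countably_additiveI)
      fix A :: "nat \<Rightarrow> 'a set" assume A: "range A \<subseteq> sets M" "disjoint_family A"
      have "(\<Sum>i. emeasure M (A i) + emeasure N (A i)) = (\<Sum>i. emeasure M (A i)) + (\<Sum>i. emeasure N (A i))"
        by (rule suminf_add[symmetric]) auto
      with A assms show "(\<Sum>i. emeasure M (A i) + emeasure N (A i)) = emeasure M (\<Union> (range A)) + emeasure N (\<Union> (range A))"
        by (simp add: suminf_emeasure)
    qed
  qed (use that in \<open>auto simp: positive_def\<close>)
  have space: "space S = space M" "space N = space M"
    using sets assms by (auto dest: sets_eq_imp_space_eq)
  have meas: "u \<in> borel_measurable S" "u \<in> borel_measurable N" if "u \<in> borel_measurable M" for u :: "'a \<Rightarrow> ennreal"
    using that by (simp_all add: measurable_cong_sets[OF sets refl] measurable_cong_sets[OF assms refl])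
  have "(\<integral>\<^sup>+z. f z \<partial>S) = (\<integral>\<^sup>+z. f z \<partial>M) + (\<integral>\<^sup>+z. f z \<partial>N)" if "f \<in> borel_measurable M" for f
    using that
  proof (induction rule: borel_measurable_induct)
    case (cong f g)
    have "(\<integral>\<^sup>+z. f z \<partial>K) = (\<integral>\<^sup>+z. g z \<partial>K)" if "space K = space M" for K
      using cong(3) that by (intro nn_integral_cong) simp
    with cong(4) space show ?case by metis
  next
    case (set A)
    then show ?case using sets assms em by simp
  next
    case (mult u c)
    then show ?case
      using meas[OF mult(2)] by (simp add: nn_integral_cmult distrib_left)
  next
    case (add u v)
    then show ?case
      using meas[OF add(1)] meas[OF add(3)] by (simp add: nn_integral_add ac_simps)
  next
    case (seq U)
    have SUP: "(\<integral>\<^sup>+z. (SUP i. U i) z \<partial>K) = (SUP i. \<integral>\<^sup>+z. U i z \<partial>K)" if "\<And>i. U i \<in> borel_measurable K" for K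
      using seq(3) that by (simp add: nn_integral_monotone_convergence_SUP image_comp)
    have "(SUP i. (\<integral>\<^sup>+z. U i z \<partial>M) + (\<integral>\<^sup>+z. U i z \<partial>N)) = (SUP i. \<integral>\<^sup>+z. U i z \<partial>M) + (SUP i. \<integral>\<^sup>+z. U i z \<partial>N)"
      using seq(3) by (intro ennreal_SUP_add) (auto simp: incseq_def le_fun_def intro!: nn_integral_mono)
    then show ?case
      using SUP[of S] SUP[of M] SUP[of N] seq meas[OF seq(1)] by simp
  qed
  with sets show thesis by (rule that)
qed

text \<open>A competitor to a given plan: keep the fraction \<open>g z\<close> of the mass at each \<open>z\<close>, and let the mass removed
at \<open>z\<close> and at \<open>w\<close> be recombined with weight \<open>k z w\<close> into mass at \<open>(fst z, snd w)\<close>. The conditions on the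
row and column integrals of \<open>k\<close> say that the recombined mass replaces exactly what was removed in each
marginal.\<close>

lemma exchange_plan:
  fixes \<pi> :: "('a::polish_space \<times> 'b::polish_space) measure"
    and g :: "'a \<times> 'b \<Rightarrow> real" and k :: "'a \<times> 'b \<Rightarrow> 'a \<times> 'b \<Rightarrow> real"
  assumes \<mu>: "prob_space \<mu>" "sets \<mu> = sets borel"
    and \<nu>: "prob_space \<nu>" "sets \<nu> = sets borel"
    and \<pi>: "\<pi> \<in> transport_plans \<mu> \<nu>"
    and g_meas [measurable]: "g \<in> borel_measurable borel" and g: "\<And>z. 0 \<le> g z" "\<And>z. g z \<le> 1"
    and k_meas [measurable]: "(\<lambda>(z, w). k z w) \<in> borel_measurable borel" and k: "\<And>z w. 0 \<le> k z w"
    and row: "\<And>z. (\<integral>\<^sup>+w. ennreal (k z w) \<partial>\<pi>) = ennreal (1 - g z)"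
    and col: "\<And>w. (\<integral>\<^sup>+z. ennreal (k z w) \<partial>\<pi>) = ennreal (1 - g w)"
  obtains \<sigma> where "\<sigma> \<in> transport_plans \<mu> \<nu>"
    "\<And>f. f \<in> borel_measurable borel \<Longrightarrow> (\<integral>\<^sup>+z. f z \<partial>\<sigma>) = (\<integral>\<^sup>+z. ennreal (g z) * f z \<partial>\<pi>) +
        (\<integral>\<^sup>+p. ennreal (k (fst p) (snd p)) * f (fst (fst p), snd (snd p)) \<partial>(\<pi> \<Otimes>\<^sub>M \<pi>))"
proof -
  note D = transport_plansD[OF \<pi>]
  interpret prob_space \<pi> by (rule D)
  have sf: "sigma_finite_measure \<pi>" ..
  interpret pp: pair_prob_space \<pi> \<pi> ..
  note [measurable_cong] = D(2)
  let ?T = "\<lambda>p :: ('a \<times> 'b) \<times> ('a \<times> 'b). (fst (fst p), snd (snd p))"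
  have [measurable_cong]: "sets (\<pi> \<Otimes>\<^sub>M \<pi>) = sets borel"
    by (rule trans[OF sets_pair_measure_cong[OF D(2) D(2)] arg_cong[OF borel_prod, of sets]])
  have fs [measurable]: "(fst :: 'a \<times> 'b \<Rightarrow> 'a) \<in> borel_measurable borel" "(snd :: 'a \<times> 'b \<Rightarrow> 'b) \<in> borel_measurable borel"
    by (simp_all add: borel_prod[symmetric])
  have fs2 [measurable]: "(fst :: ('a \<times> 'b) \<times> ('a \<times> 'b) \<Rightarrow> 'a \<times> 'b) \<in> borel_measurable borel"
    "(snd :: ('a \<times> 'b) \<times> ('a \<times> 'b) \<Rightarrow> 'a \<times> 'b) \<in> borel_measurable borel"
    by (simp_all add: borel_prod[symmetric])
  have T [measurable]: "?T \<in> borel_measurable borel"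
    by (intro borel_measurable_Pair measurable_compose[OF fs2(1) fs(1)] measurable_compose[OF fs2(2) fs(2)])
  have k' [measurable]: "(\<lambda>p. k (fst p) (snd p)) \<in> borel_measurable borel"
    using k_meas by (simp add: split_beta')
  define \<rho> where "\<rho> = distr (density (\<pi> \<Otimes>\<^sub>M \<pi>) (\<lambda>p. ennreal (k (fst p) (snd p)))) borel ?T"
  have \<rho>: "(\<integral>\<^sup>+z. f z \<partial>\<rho>) = (\<integral>\<^sup>+p. ennreal (k (fst p) (snd p)) * f (?T p) \<partial>(\<pi> \<Otimes>\<^sub>M \<pi>))"
    if [measurable]: "f \<in> borel_measurable borel" for f
    unfolding \<rho>_def by (subst nn_integral_distr; (subst nn_integral_density)?) auto
  have "sets \<rho> = sets (density \<pi> (\<lambda>z. ennreal (g z)))"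
    by (simp add: \<rho>_def D(2))
  then obtain \<sigma> where \<sigma>: "sets \<sigma> = sets (density \<pi> (\<lambda>z. ennreal (g z)))"
    and sum: "\<And>f. f \<in> borel_measurable (density \<pi> (\<lambda>z. ennreal (g z))) \<Longrightarrow>
      (\<integral>\<^sup>+z. f z \<partial>\<sigma>) = (\<integral>\<^sup>+z. f z \<partial>density \<pi> (\<lambda>z. ennreal (g z))) + (\<integral>\<^sup>+z. f z \<partial>\<rho>)"
    using measure_sum_exists by blast
  have int: "(\<integral>\<^sup>+z. f z \<partial>\<sigma>) = (\<integral>\<^sup>+z. ennreal (g z) * f z \<partial>\<pi>) +
      (\<integral>\<^sup>+p. ennreal (k (fst p) (snd p)) * f (?T p) \<partial>(\<pi> \<Otimes>\<^sub>M \<pi>))"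
    if [measurable]: "f \<in> borel_measurable borel" for f
    by (subst sum) (auto simp: \<rho> nn_integral_density)
  have fill: "ennreal (g z) * x + ennreal (1 - g z) * x = x" for z x
    using g[of z] by (simp add: distrib_right[symmetric] ennreal_plus[symmetric] del: ennreal_plus)
  have "\<sigma> \<in> transport_plans \<mu> \<nu>"
  proof (rule transport_planI[OF \<mu>(1) \<nu>(1) \<mu>(2) \<nu>(2)])
    show sets_\<sigma>: "sets \<sigma> = sets borel" by (simp add: \<sigma> D(2))
    \<comment> \<open>Integrate \<open>k z w\<close> over \<open>w\<close> first: only \<open>fst z\<close> matters for the first marginal.\<close>
    show "emeasure \<sigma> (A \<times> UNIV) = emeasure \<mu> A" if [measurable]: "A \<in> sets borel" for A
    proof -
      have [measurable]: "A \<times> (UNIV :: 'b set) \<in> sets borel"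
        by (simp add: borel_prod[symmetric])
      have "emeasure \<sigma> (A \<times> UNIV) = (\<integral>\<^sup>+z. indicator (A \<times> UNIV) z \<partial>\<sigma>)"
        by (simp add: sets_\<sigma>)
      also have "\<dots> = (\<integral>\<^sup>+z. ennreal (g z) * indicator (A \<times> UNIV) z \<partial>\<pi>) +
         (\<integral>\<^sup>+p. ennreal (k (fst p) (snd p)) * indicator (A \<times> UNIV) (fst p) \<partial>(\<pi> \<Otimes>\<^sub>M \<pi>))"
        by (subst int) (auto simp: indicator_def mem_Times_iff)
      also have "(\<integral>\<^sup>+p. ennreal (k (fst p) (snd p)) * indicator (A \<times> UNIV) (fst p) \<partial>(\<pi> \<Otimes>\<^sub>M \<pi>))
         = (\<integral>\<^sup>+z. \<integral>\<^sup>+w. ennreal (k z w) * indicator (A \<times> UNIV) z \<partial>\<pi> \<partial>\<pi>)"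
        using sigma_finite_measure.nn_integral_fst[OF sf, of "\<lambda>p. ennreal (k (fst p) (snd p)) * indicator (A \<times> UNIV) (fst p)" \<pi>] by simp
      also have "\<dots> = (\<integral>\<^sup>+z. ennreal (1 - g z) * indicator (A \<times> UNIV) z \<partial>\<pi>)"
        by (intro nn_integral_cong) (simp add: row split: split_indicator)
      also have "(\<integral>\<^sup>+z. ennreal (g z) * indicator (A \<times> UNIV) z \<partial>\<pi>) + (\<integral>\<^sup>+z. ennreal (1 - g z) * indicator (A \<times> UNIV) z \<partial>\<pi>)
          = (\<integral>\<^sup>+z. indicator (A \<times> UNIV) z \<partial>\<pi>)"
        by (subst nn_integral_add[symmetric]) (auto simp: fill)
      also have "\<dots> = emeasure \<pi> (A \<times> UNIV)"
        by (simp add: D(2))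
      also have "\<dots> = emeasure \<mu> A"
        using measure_plan_marginals(1)[OF \<pi> that]
        by (simp add: emeasure_eq_measure finite_measure.emeasure_eq_measure[OF prob_space.finite_measure[OF \<mu>(1)]])
      finally show ?thesis .
    qed
    show "emeasure \<sigma> (UNIV \<times> B) = emeasure \<nu> B" if [measurable]: "B \<in> sets borel" for B
    proof -
      have [measurable]: "(UNIV :: 'a set) \<times> B \<in> sets borel"
        by (simp add: borel_prod[symmetric])
      have "emeasure \<sigma> (UNIV \<times> B) = (\<integral>\<^sup>+z. indicator (UNIV \<times> B) z \<partial>\<sigma>)"
        by (simp add: sets_\<sigma>)
      also have "\<dots> = (\<integral>\<^sup>+z. ennreal (g z) * indicator (UNIV \<times> B) z \<partial>\<pi>) +
         (\<integral>\<^sup>+p. ennreal (k (fst p) (snd p)) * indicator (UNIV \<times> B) (snd p) \<partial>(\<pi> \<Otimes>\<^sub>M \<pi>))"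
        by (subst int) (auto simp: indicator_def mem_Times_iff)
      also have "(\<integral>\<^sup>+p. ennreal (k (fst p) (snd p)) * indicator (UNIV \<times> B) (snd p) \<partial>(\<pi> \<Otimes>\<^sub>M \<pi>))
         = (\<integral>\<^sup>+w. \<integral>\<^sup>+z. ennreal (k z w) * indicator (UNIV \<times> B) w \<partial>\<pi> \<partial>\<pi>)"
        using pp.nn_integral_snd[of "\<lambda>p. ennreal (k (fst p) (snd p)) * indicator (UNIV \<times> B) (snd p)"] by simp
      also have "\<dots> = (\<integral>\<^sup>+w. ennreal (1 - g w) * indicator (UNIV \<times> B) w \<partial>\<pi>)"
        by (intro nn_integral_cong) (simp add: col split: split_indicator)
      also have "(\<integral>\<^sup>+z. ennreal (g z) * indicator (UNIV \<times> B) z \<partial>\<pi>) + (\<integral>\<^sup>+z. ennreal (1 - g z) * indicator (UNIV \<times> B) z \<partial>\<pi>)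
          = (\<integral>\<^sup>+z. indicator (UNIV \<times> B) z \<partial>\<pi>)"
        by (subst nn_integral_add[symmetric]) (auto simp: fill)
      also have "\<dots> = emeasure \<pi> (UNIV \<times> B)"
        by (simp add: D(2))
      also have "\<dots> = emeasure \<nu> B"
        using measure_plan_marginals(2)[OF \<pi> that]
        by (simp add: emeasure_eq_measure finite_measure.emeasure_eq_measure[OF prob_space.finite_measure[OF \<nu>(1)]])
      finally show ?thesis .
    qed
  qed
  then show thesis
    using int by (rule that)
qed

lemma ereal_integral_eq_integral:
  assumes "integrable M g" "AE z in M. f z = ereal (g z)"
  shows "ereal_integral M f = ereal (\<integral>z. g z \<partial>M)"
proof -
  have "(\<integral>\<^sup>+z. e2ennreal (f z) \<partial>M) = (\<integral>\<^sup>+z. ennreal (g z) \<partial>M)"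
    using assms(2) by (intro nn_integral_cong_AE) (auto simp: ennreal.abs_eq)
  moreover have "(\<integral>\<^sup>+z. e2ennreal (- f z) \<partial>M) = (\<integral>\<^sup>+z. ennreal (- g z) \<partial>M)"
    using assms(2) by (intro nn_integral_cong_AE) (auto simp: ennreal.abs_eq)
  moreover obtain p where "(\<integral>\<^sup>+z. ennreal (g z) \<partial>M) = ennreal p" "0 \<le> p"
    using assms(1) by (cases "\<integral>\<^sup>+z. ennreal (g z) \<partial>M") (auto simp: real_integrable_def)
  moreover obtain n where "(\<integral>\<^sup>+z. ennreal (- g z) \<partial>M) = ennreal n" "0 \<le> n"
    using assms(1) by (cases "\<integral>\<^sup>+z. ennreal (- g z) \<partial>M") (auto simp: real_integrable_def)
  ultimately show ?thesis
    unfolding ereal_integral_def real_lebesgue_integral_def[OF assms(1)] by simp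
qed

section \<open>Cyclical monotonicity of optimal plans\<close>

definition topological_support :: "'a::topological_space measure \<Rightarrow> 'a set" where
  "topological_support M = {z. \<forall>U. open U \<longrightarrow> z \<in> U \<longrightarrow> 0 < measure M U}"

lemma continuous_near_on_rectangle:
  fixes c :: "'a::metric_space \<Rightarrow> 'b::metric_space \<Rightarrow> ereal"
  assumes c: "continuous_on UNIV (\<lambda>(x, y). c x y)" and "l < c x y" "c x y < u"
  obtains d where "0 < d" "\<And>x' y'. dist x x' < d \<Longrightarrow> dist y y' < d \<Longrightarrow> l < c x' y' \<and> c x' y' < u"
proof -
  have "open ((\<lambda>(x, y). c x y) -` {l<..<u})"
    using c by (intro open_vimage) auto
  moreover have "(x, y) \<in> (\<lambda>(x, y). c x y) -` {l<..<u}"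
    using assms by auto
  ultimately obtain U V where UV: "open U" "open V" "(x, y) \<in> U \<times> V" "U \<times> V \<subseteq> (\<lambda>(x, y). c x y) -` {l<..<u}"
    by (rule open_prod_elim)
  obtain d1 where d1: "0 < d1" "ball x d1 \<subseteq> U"
    using UV(1,3) by (auto elim: openE)
  obtain d2 where d2: "0 < d2" "ball y d2 \<subseteq> V"
    using UV(2,3) by (auto elim: openE)
  show thesis
  proof (rule that)
    show "0 < min d1 d2" using d1 d2 by simp
    fix x' y' assume "dist x x' < min d1 d2" "dist y y' < min d1 d2"
    then have "(x', y') \<in> U \<times> V"
      using d1(2) d2(2) by (auto simp: subset_iff)
    then show "l < c x' y' \<and> c x' y' < u"
      using UV(4) by auto
  qed
qed

lemma sum_shift_cyclic:
  fixes F :: "nat \<Rightarrow> 'a::ab_group_add"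
  assumes "F N = F 0"
  shows "(\<Sum>i<N. F (Suc i)) = (\<Sum>i<N. F i)"
  using sum.lessThan_Suc_shift[of F N] sum.lessThan_Suc[of F N] assms by (simp add: add.commute)

text \<open>If permuting the partners along a finite cycle of support points were strictly cheaper, then by
continuity the same would hold with a margin for all points near the cycle. Small neighbourhoods
\<open>W i\<close> of the points have positive mass \<open>m i\<close>; moving the same small amount of mass from each of them,
and rematching the first coordinates near \<open>p (i + 1)\<close> with the second coordinates near \<open>p i\<close>, gives a
plan of smaller cost. The cost stays finite because it is bounded on the rectangles that receive mass.\<close>

theorem optimal_plan_cyclically_monotone:
  fixes c :: "'a::polish_space \<Rightarrow> 'b::polish_space \<Rightarrow> ereal"
  defines "r \<equiv> \<lambda>x y. real_of_ereal (c x y)"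
  assumes \<mu>: "prob_space \<mu>" "sets \<mu> = sets borel"
    and \<nu>: "prob_space \<nu>" "sets \<nu> = sets borel"
    and c: "continuous_on UNIV (\<lambda>(x, y). c x y)" and c_minf: "\<And>x y. c x y \<noteq> -\<infinity>"
    and opt: "optimal_plan c \<mu> \<nu> \<pi>"
    and int_r: "integrable \<pi> (\<lambda>(x, y). r x y)" and finite: "AE (x, y) in \<pi>. c x y < \<infinity>"
    and p: "\<And>i. i \<le> N \<Longrightarrow> p i \<in> topological_support \<pi>" "p N = p 0"
    and fin_p: "\<And>i. i < N \<Longrightarrow> c (fst (p i)) (snd (p i)) < \<infinity>"
    and fin_cross: "\<And>i. i < N \<Longrightarrow> c (fst (p (Suc i))) (snd (p i)) < \<infinity>"
  shows "(\<Sum>i<N. r (fst (p i)) (snd (p i))) \<le> (\<Sum>i<N. r (fst (p (Suc i))) (snd (p i)))"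
proof (rule ccontr)
  define D where "D i = r (fst (p i)) (snd (p i))" for i
  define C where "C i = r (fst (p (Suc i))) (snd (p i))" for i
  assume "\<not> ?thesis"
  then have lt: "(\<Sum>i<N. C i) < (\<Sum>i<N. D i)"
    by (simp add: C_def D_def)
  then have N: "0 < N" by (cases N) auto
  have \<pi>: "\<pi> \<in> transport_plans \<mu> \<nu>" and min: "plan_cost c \<pi> = total_cost c \<mu> \<nu>"
    using opt by (auto simp: optimal_plan_def)
  note TD = transport_plansD[OF \<pi>]
  interpret prob_space \<pi> by (rule TD)
  interpret pp: pair_prob_space \<pi> \<pi> ..
  \<comment> \<open>With this margin the total error \<open>2 * N * e\<close> stays below the gain of the permutation.\<close>
  define e where "e = ((\<Sum>i<N. D i) - (\<Sum>i<N. C i)) / (3 * N)"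
  have e: "0 < e" using lt N by (simp add: e_def)
  have sum_e: "(\<Sum>i<N. C i + e) < (\<Sum>i<N. D i - e)"
  proof -
    have "N * e = ((\<Sum>i<N. D i) - (\<Sum>i<N. C i)) / 3"
      using N by (simp add: e_def)
    then show ?thesis
      using lt by (simp add: sum.distrib sum_subtractf algebra_simps)
  qed
  have ereal_r: "c x y = ereal (r x y)" if "c x y < \<infinity>" for x y
    using that c_minf[of x y] by (cases "c x y") (auto simp: r_def)

  have "\<exists>d>0. \<forall>x y. (dist (fst (p (Suc i))) x < d \<longrightarrow> dist (snd (p i)) y < d \<longrightarrow> c x y < \<infinity> \<and> \<bar>r x y - C i\<bar> < e) \<and>
      (dist (fst (p i)) x < d \<longrightarrow> dist (snd (p i)) y < d \<longrightarrow> c x y < \<infinity> \<and> \<bar>r x y - D i\<bar> < e)" if "i < N" for i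
  proof -
    have near: "c x y < \<infinity> \<and> \<bar>r x y - q\<bar> < e" if "ereal (q - e) < c x y \<and> c x y < ereal (q + e)" for x y q
      using that by (cases "c x y") (auto simp: r_def)
    obtain d1 where d1: "0 < d1" "\<And>x' y'. dist (fst (p (Suc i))) x' < d1 \<Longrightarrow> dist (snd (p i)) y' < d1 \<Longrightarrow>
        ereal (C i - e) < c x' y' \<and> c x' y' < ereal (C i + e)"
      using e ereal_r[OF fin_cross[OF \<open>i < N\<close>]]
      by (auto intro: continuous_near_on_rectangle[OF c, of "ereal (C i - e)" "fst (p (Suc i))" "snd (p i)" "ereal (C i + e)"]
          simp: C_def)
    obtain d2 where d2: "0 < d2" "\<And>x' y'. dist (fst (p i)) x' < d2 \<Longrightarrow> dist (snd (p i)) y' < d2 \<Longrightarrow>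
        ereal (D i - e) < c x' y' \<and> c x' y' < ereal (D i + e)"
      using e ereal_r[OF fin_p[OF \<open>i < N\<close>]]
      by (auto intro: continuous_near_on_rectangle[OF c, of "ereal (D i - e)" "fst (p i)" "snd (p i)" "ereal (D i + e)"]
          simp: D_def)
    show ?thesis
      using d1(1) d2(1) near[OF d1(2)] near[OF d2(2)] by (intro exI[of _ "min d1 d2"]) simp
  qed
  then obtain d where d: "\<And>i. i < N \<Longrightarrow> 0 < d i"
    "\<And>i x y. i < N \<Longrightarrow> dist (fst (p (Suc i))) x < d i \<Longrightarrow> dist (snd (p i)) y < d i \<Longrightarrow> c x y < \<infinity> \<and> \<bar>r x y - C i\<bar> < e"
    "\<And>i x y. i < N \<Longrightarrow> dist (fst (p i)) x < d i \<Longrightarrow> dist (snd (p i)) y < d i \<Longrightarrow> c x y < \<infinity> \<and> \<bar>r x y - D i\<bar> < e"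
    by metis
  define R where "R = Min (d ` {..<N})"
  have R: "0 < R" "\<And>i. i < N \<Longrightarrow> R \<le> d i"
  proof -
    have "{..<N} \<noteq> {}" using N by auto
    then show "0 < R" using d(1) by (simp add: R_def)
  qed (auto simp: R_def)
  define W where "W i = ball (fst (p i)) R \<times> ball (snd (p i)) R" for i
  have W_open: "open (W i)" for i
    by (auto simp: W_def intro: open_Times)
  have W_per: "W N = W 0" by (simp add: W_def p(2))
  have near_C: "c (fst z) (snd w) < \<infinity> \<and> \<bar>r (fst z) (snd w) - C i\<bar> < e"
    if "i < N" "z \<in> W (Suc i)" "w \<in> W i" for i z w
    using that R(2)[of i] by (intro d(2)) (auto simp: W_def)
  have near_D: "\<bar>r (fst z) (snd z) - D i\<bar> < e" if "i < N" "z \<in> W i" for i z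
    using that R(2)[of i] d(3)[of i "fst z" "snd z"] by (auto simp: W_def)
  define m where "m i = measure \<pi> (W i)" for i
  have m: "0 < m i" if "i \<le> N" for i
    using p(1)[OF that] W_open[of i] R(1) by (auto simp: topological_support_def m_def W_def mem_Times_iff)
  have m_per: "m N = m 0" by (simp add: m_def W_per)
  \<comment> \<open>\<open>L\<close> is the mass taken from each neighbourhood. The weights \<open>L / m i\<close> sum to one, so that never more than
    the available mass is removed, even where the neighbourhoods overlap.\<close>
  define L where "L = 1 / (\<Sum>i<N. 1 / m i)"
  have "0 < (\<Sum>i<N. 1 / m i)"
    using N m by (intro sum_pos) auto
  then have L: "0 < L" "L * (\<Sum>i<N. 1 / m i) = 1"
    by (auto simp: L_def)
  define h where "h z = (\<Sum>i<N. L / m i * indicator (W i) z)" for z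
  define g where "g z = 1 - h z" for z
  define k where "k z w = (\<Sum>i<N. L / (m (Suc i) * m i) * (indicator (W (Suc i)) z * indicator (W i) w))" for z w
  note [measurable_cong] = TD(2)
  have [measurable]: "W i \<in> sets borel" for i
    using W_open by (rule borel_open)
  have [measurable]: "h \<in> borel_measurable borel" "g \<in> borel_measurable borel"
    unfolding h_def[abs_def] g_def[abs_def] by measurable
  have [measurable]: "(fst :: ('a \<times> 'b) \<times> ('a \<times> 'b) \<Rightarrow> 'a \<times> 'b) \<in> borel_measurable borel"
    "(snd :: ('a \<times> 'b) \<times> ('a \<times> 'b) \<Rightarrow> 'a \<times> 'b) \<in> borel_measurable borel"
    by (simp_all add: borel_prod[symmetric])
  have [measurable_cong]: "sets (\<pi> \<Otimes>\<^sub>M \<pi>) = sets borel"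
    by (rule trans[OF sets_pair_measure_cong[OF TD(2) TD(2)] arg_cong[OF borel_prod, of sets]])
  have k_meas [measurable]: "(\<lambda>p. k (fst p) (snd p)) \<in> borel_measurable borel"
    unfolding k_def[abs_def] by measurable
  have h_nonneg: "0 \<le> h z" for z
    unfolding h_def using L m by (intro sum_nonneg) (auto intro!: mult_nonneg_nonneg divide_nonneg_pos)
  have h_le: "h z \<le> 1" for z
  proof -
    have "h z \<le> (\<Sum>i<N. L / m i)"
      unfolding h_def using L m by (intro sum_mono) (auto split: split_indicator intro!: divide_nonneg_pos)
    also have "\<dots> = 1"
      using L(2) by (simp add: sum_distrib_left)
    finally show ?thesis .
  qed
  have k_nonneg: "0 \<le> k z w" for z w
    unfolding k_def using L m by (intro sum_nonneg) (auto intro!: mult_nonneg_nonneg divide_nonneg_pos)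
  have row: "(\<integral>\<^sup>+w. ennreal (k z w) \<partial>\<pi>) = ennreal (1 - g z)" for z
  proof -
    have int: "integrable \<pi> (\<lambda>w. k z w)"
      unfolding k_def by (intro Bochner_Integration.integrable_sum integrable_mult_right integrable_real_indicator) (auto simp: emeasure_eq_measure TD)
    have "(\<integral>w. k z w \<partial>\<pi>) = (\<Sum>i<N. L / (m (Suc i) * m i) * (indicator (W (Suc i)) z * m i))"
      unfolding k_def by (simp add: TD emeasure_eq_measure m_def[symmetric])
    also have "\<dots> = (\<Sum>i<N. L / m (Suc i) * indicator (W (Suc i)) z)"
      using m by (intro sum.cong) (auto simp: less_imp_neq[symmetric])
    also have "\<dots> = h z"
      unfolding h_def by (rule sum_shift_cyclic) (simp add: W_per m_per)
    finally show ?thesis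
      using int k_nonneg by (subst nn_integral_eq_integral) (auto simp: g_def)
  qed
  have col: "(\<integral>\<^sup>+z. ennreal (k z w) \<partial>\<pi>) = ennreal (1 - g w)" for w
  proof -
    have int: "integrable \<pi> (\<lambda>z. k z w)"
      unfolding k_def by (intro Bochner_Integration.integrable_sum integrable_mult_right integrable_mult_left integrable_real_indicator) (auto simp: emeasure_eq_measure TD)
    have "(\<integral>z. k z w \<partial>\<pi>) = (\<Sum>i<N. L / (m (Suc i) * m i) * (m (Suc i) * indicator (W i) w))"
      unfolding k_def by (simp add: TD emeasure_eq_measure m_def[symmetric])
    also have "\<dots> = h w"
      unfolding h_def using m by (intro sum.cong) (auto simp: less_imp_neq[symmetric])
    finally show ?thesis
      using int k_nonneg by (subst nn_integral_eq_integral) (auto simp: g_def)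
  qed
  obtain \<sigma> where \<sigma>: "\<sigma> \<in> transport_plans \<mu> \<nu>"
    and int_\<sigma>: "\<And>f. f \<in> borel_measurable borel \<Longrightarrow> (\<integral>\<^sup>+z. f z \<partial>\<sigma>) = (\<integral>\<^sup>+z. ennreal (g z) * f z \<partial>\<pi>) +
        (\<integral>\<^sup>+p. ennreal (k (fst p) (snd p)) * f (fst (fst p), snd (snd p)) \<partial>(\<pi> \<Otimes>\<^sub>M \<pi>))"
    using exchange_plan[OF \<mu> \<nu> \<pi>, of g k] h_nonneg h_le k_nonneg row col
    by (auto simp: g_def split_beta')

  \<comment> \<open>It remains to compare the costs; \<open>\<rho>\<close> is the cost as a real-valued function on the product.\<close>
  define \<rho> where "\<rho> z = r (fst z) (snd z)" for z
  have c_meas [measurable]: "(\<lambda>z. c (fst z) (snd z)) \<in> borel_measurable borel"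
    using borel_measurable_continuous_onI[OF c] by (simp add: split_beta')
  have [measurable]: "\<rho> \<in> borel_measurable borel"
    unfolding \<rho>_def[abs_def] r_def by measurable
  have int_\<rho>: "integrable \<pi> \<rho>"
    using int_r by (simp add: \<rho>_def[abs_def] split_beta')
  define K where "K p = k (fst p) (snd p) * \<rho> (fst (fst p), snd (snd p))" for p
  have [measurable]: "(\<lambda>p :: ('a \<times> 'b) \<times> ('a \<times> 'b). (fst (fst p), snd (snd p))) \<in> borel_measurable borel"
  proof -
    have "(fst :: 'a \<times> 'b \<Rightarrow> 'a) \<in> borel_measurable borel" "(snd :: 'a \<times> 'b \<Rightarrow> 'b) \<in> borel_measurable borel"
      by (simp_all add: borel_prod[symmetric])
    then show ?thesis by measurable
  qed
  have [measurable]: "K \<in> borel_measurable borel"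
    unfolding K_def[abs_def] by measurable
  have K_eq: "K p = (\<Sum>i<N. L / (m (Suc i) * m i) *
      (indicator (W (Suc i)) (fst p) * indicator (W i) (snd p) * \<rho> (fst (fst p), snd (snd p))))" for p
    by (simp add: K_def k_def sum_distrib_right mult.assoc)
  have coeff: "0 \<le> L / (m (Suc i) * m i)" if "i < N" for i
    using L m[of i] m[of "Suc i"] that by simp
  have K_bd: "norm (K p) \<le> (\<Sum>i<N. L / (m (Suc i) * m i) * (\<bar>C i\<bar> + e))" for p
    unfolding K_eq
  proof (rule sum_norm_le)
    fix i assume i: "i \<in> {..<N}"
    have "\<bar>indicator (W (Suc i)) (fst p) * indicator (W i) (snd p) * \<rho> (fst (fst p), snd (snd p))\<bar> \<le> \<bar>C i\<bar> + e"
      using near_C[of i "fst p" "snd p"] i e by (auto simp: \<rho>_def split: split_indicator)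
    moreover have "norm (q * x) \<le> q * b" if "0 \<le> q" "\<bar>x\<bar> \<le> b" for q x b :: real
      using that by (simp add: abs_mult mult_left_mono)
    ultimately show "norm (L / (m (Suc i) * m i) * (indicator (W (Suc i)) (fst p) * indicator (W i) (snd p) * \<rho> (fst (fst p), snd (snd p))))
        \<le> L / (m (Suc i) * m i) * (\<bar>C i\<bar> + e)"
      using coeff[of i] i by blast
  qed
  have int_K: "integrable (\<pi> \<Otimes>\<^sub>M \<pi>) K"
    by (rule pp.P.integrable_const_bound[OF always_eventually[OF allI[OF K_bd]]]) simp
  have K_le: "(\<integral>p. K p \<partial>(\<pi> \<Otimes>\<^sub>M \<pi>)) \<le> L * (\<Sum>i<N. C i + e)"
  proof -
    have prod: "measure (\<pi> \<Otimes>\<^sub>M \<pi>) (W (Suc i) \<times> W i) = m (Suc i) * m i" for i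
    proof -
      have "emeasure (\<pi> \<Otimes>\<^sub>M \<pi>) (W (Suc i) \<times> W i) = emeasure \<pi> (W (Suc i)) * emeasure \<pi> (W i)"
        by (rule emeasure_pair_measure_Times) (auto simp: TD)
      then show ?thesis
        by (simp add: measure_def m_def enn2real_mult)
    qed
    have rect: "W (Suc i) \<times> W i \<in> sets (\<pi> \<Otimes>\<^sub>M \<pi>)" for i
      by (intro pair_measureI) (auto simp: TD)
    have "(\<integral>p. K p \<partial>(\<pi> \<Otimes>\<^sub>M \<pi>)) \<le> (\<integral>p. (\<Sum>i<N. L / (m (Suc i) * m i) * (C i + e) * indicator (W (Suc i) \<times> W i) p) \<partial>(\<pi> \<Otimes>\<^sub>M \<pi>))"
    proof (rule integral_mono[OF int_K])
      show "integrable (\<pi> \<Otimes>\<^sub>M \<pi>) (\<lambda>p. \<Sum>i<N. L / (m (Suc i) * m i) * (C i + e) * indicator (W (Suc i) \<times> W i) p)"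
        using rect by (intro Bochner_Integration.integrable_sum integrable_mult_right integrable_real_indicator) (auto simp: pp.P.emeasure_eq_measure)
      fix p
      show "K p \<le> (\<Sum>i<N. L / (m (Suc i) * m i) * (C i + e) * indicator (W (Suc i) \<times> W i) p)"
        unfolding K_eq
      proof (rule sum_mono)
        fix i assume i: "i \<in> {..<N}"
        have "indicator (W (Suc i)) (fst p) * indicator (W i) (snd p) * \<rho> (fst (fst p), snd (snd p))
            \<le> (C i + e) * indicator (W (Suc i) \<times> W i) p"
          using near_C[of i "fst p" "snd p"] i by (auto simp: \<rho>_def mem_Times_iff split: split_indicator)
        then show "L / (m (Suc i) * m i) * (indicator (W (Suc i)) (fst p) * indicator (W i) (snd p) * \<rho> (fst (fst p), snd (snd p)))
            \<le> L / (m (Suc i) * m i) * (C i + e) * indicator (W (Suc i) \<times> W i) p"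
          using coeff[of i] i unfolding mult.assoc by (intro mult_left_mono) (auto simp: mult.assoc)
      qed
    qed
    also have "\<dots> = (\<Sum>i<N. L / (m (Suc i) * m i) * (C i + e) * (m (Suc i) * m i))"
      using rect by (subst Bochner_Integration.integral_sum) (auto simp: pp.P.emeasure_eq_measure prod)
    also have "\<dots> = (\<Sum>i<N. L * (C i + e))"
      using m by (intro sum.cong) (auto simp: less_imp_neq[symmetric])
    finally show ?thesis by (simp add: sum_distrib_left)
  qed
  have int_W\<rho>: "integrable \<pi> (\<lambda>z. \<rho> z * indicator (W i) z)" for i
    by (rule integrable_real_mult_indicator[OF _ int_\<rho>]) (simp add: TD)
  have g\<rho>: "g z * \<rho> z = \<rho> z - (\<Sum>i<N. L / m i * (\<rho> z * indicator (W i) z))" for z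
    by (simp add: g_def h_def algebra_simps sum_distrib_left)
  have int_g\<rho>: "integrable \<pi> (\<lambda>z. g z * \<rho> z)"
    unfolding g\<rho> by (intro Bochner_Integration.integrable_diff Bochner_Integration.integrable_sum integrable_mult_right int_\<rho> int_W\<rho>)
  have g\<rho>_le: "(\<integral>z. g z * \<rho> z \<partial>\<pi>) \<le> (\<integral>z. \<rho> z \<partial>\<pi>) - L * (\<Sum>i<N. D i - e)"
  proof -
    have "L * (D i - e) \<le> L / m i * (\<integral>z. \<rho> z * indicator (W i) z \<partial>\<pi>)" if "i < N" for i
    proof -
      have "(D i - e) * m i = (\<integral>z. (D i - e) * indicator (W i) z \<partial>\<pi>)"
        by (simp add: TD m_def)
      also have "\<dots> \<le> (\<integral>z. \<rho> z * indicator (W i) z \<partial>\<pi>)"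
      proof (intro integral_mono int_W\<rho>)
        show "(D i - e) * indicator (W i) z \<le> \<rho> z * indicator (W i) z" for z
          using near_D[OF that, of z] by (auto simp: \<rho>_def abs_less_iff split: split_indicator)
      qed (auto simp: emeasure_eq_measure TD)
      finally have "L / m i * ((D i - e) * m i) \<le> L / m i * (\<integral>z. \<rho> z * indicator (W i) z \<partial>\<pi>)"
        using m[of i] L(1) that by (intro mult_left_mono) auto
      then show ?thesis
        using m[of i] that by simp
    qed
    then have "L * (\<Sum>i<N. D i - e) \<le> (\<Sum>i<N. L / m i * (\<integral>z. \<rho> z * indicator (W i) z \<partial>\<pi>))"
      unfolding sum_distrib_left by (intro sum_mono) auto
    also have "\<dots> = (\<integral>z. \<rho> z \<partial>\<pi>) - (\<integral>z. g z * \<rho> z \<partial>\<pi>)"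
      unfolding g\<rho> using int_\<rho> int_W\<rho> by (simp add: Bochner_Integration.integral_diff Bochner_Integration.integral_sum)
    finally show ?thesis by simp
  qed
  \<comment> \<open>The factor \<open>s\<close> is used for \<open>1\<close> and \<open>-1\<close>, that is, for the positive and the negative part.\<close>
  have split_nn: "(\<integral>\<^sup>+z. ennreal (s * \<rho> z) \<partial>\<sigma>) = (\<integral>\<^sup>+z. ennreal (s * (g z * \<rho> z)) \<partial>\<pi>) + (\<integral>\<^sup>+p. ennreal (s * K p) \<partial>(\<pi> \<Otimes>\<^sub>M \<pi>))" for s
  proof -
    have "ennreal (g z) * ennreal (s * \<rho> z) = ennreal (s * (g z * \<rho> z))" for z
      using h_le[of z] by (subst ennreal_mult'[symmetric]) (auto simp: g_def ac_simps)
    moreover have "ennreal (k (fst p) (snd p)) * ennreal (s * \<rho> (fst (fst p), snd (snd p))) = ennreal (s * K p)" for p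
      using k_nonneg by (subst ennreal_mult'[symmetric]) (auto simp: K_def ac_simps)
    ultimately show ?thesis
      using int_\<sigma>[of "\<lambda>z. ennreal (s * \<rho> z)"] by simp
  qed
  note nn = split_nn[of 1, simplified] split_nn[of "-1", simplified]
  note T\<sigma> = transport_plansD[OF \<sigma>]
  have int_\<sigma>\<rho>: "integrable \<sigma> \<rho>"
    using int_g\<rho> int_K by (auto simp: real_integrable_def nn measurable_cong_sets[OF T\<sigma>(2) refl])
  have "(\<integral>z. \<rho> z \<partial>\<sigma>) = (\<integral>z. g z * \<rho> z \<partial>\<pi>) + (\<integral>p. K p \<partial>(\<pi> \<Otimes>\<^sub>M \<pi>))"
    using int_g\<rho> int_K
    unfolding real_lebesgue_integral_def[OF int_\<sigma>\<rho>] real_lebesgue_integral_def[OF int_g\<rho>] real_lebesgue_integral_def[OF int_K] nn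
    by (simp add: real_integrable_def enn2real_plus less_top)
  also have "\<dots> \<le> (\<integral>z. \<rho> z \<partial>\<pi>) - L * (\<Sum>i<N. D i - e) + L * (\<Sum>i<N. C i + e)"
    using K_le g\<rho>_le by simp
  also have "\<dots> < (\<integral>z. \<rho> z \<partial>\<pi>)"
    using sum_e L(1) by simp
  finally have less: "(\<integral>z. \<rho> z \<partial>\<sigma>) < (\<integral>z. \<rho> z \<partial>\<pi>)" .
  have fin_\<sigma>: "AE z in \<sigma>. c (fst z) (snd z) < \<infinity>"
  proof -
    define F where "F = {z. c (fst z) (snd z) = \<infinity>}"
    have F [measurable]: "F \<in> sets borel"
      unfolding F_def using measurable_sets[OF c_meas, of "{\<infinity>}"] by (simp add: vimage_def)
    have "emeasure \<sigma> F = (\<integral>\<^sup>+z. indicator F z \<partial>\<sigma>)"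
      by (simp add: T\<sigma>)
    also have "\<dots> = (\<integral>\<^sup>+z. ennreal (g z) * indicator F z \<partial>\<pi>) +
        (\<integral>\<^sup>+p. ennreal (k (fst p) (snd p)) * indicator F (fst (fst p), snd (snd p)) \<partial>(\<pi> \<Otimes>\<^sub>M \<pi>))"
      by (rule int_\<sigma>) simp
    also have "(\<integral>\<^sup>+z. ennreal (g z) * indicator F z \<partial>\<pi>) = (\<integral>\<^sup>+z. 0 \<partial>\<pi>)"
      using finite by (intro nn_integral_cong_AE) (auto simp: F_def)
    also have "(\<integral>\<^sup>+p. ennreal (k (fst p) (snd p)) * indicator F (fst (fst p), snd (snd p)) \<partial>(\<pi> \<Otimes>\<^sub>M \<pi>)) = (\<integral>\<^sup>+p. 0 \<partial>(\<pi> \<Otimes>\<^sub>M \<pi>))"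
    proof (rule nn_integral_cong)
      fix p
      have "k (fst p) (snd p) = 0" if "(fst (fst p), snd (snd p)) \<in> F"
        unfolding k_def using near_C[of _ "fst p" "snd p"] that
        by (intro sum.neutral) (auto simp: F_def split: split_indicator)
      then show "ennreal (k (fst p) (snd p)) * indicator F (fst (fst p), snd (snd p)) = 0"
        by (auto split: split_indicator)
    qed
    finally have "emeasure \<sigma> F = 0" by simp
    then show ?thesis
      by (intro AE_I[of _ _ F]) (auto simp: F_def T\<sigma>(2) F[unfolded F_def])
  qed
  have cost: "plan_cost c \<tau> = ereal (\<integral>z. \<rho> z \<partial>\<tau>)" if "integrable \<tau> \<rho>" "AE z in \<tau>. c (fst z) (snd z) < \<infinity>" for \<tau>
    unfolding plan_cost_def
    by (rule ereal_integral_eq_integral[OF that(1)]) (use that(2) in \<open>auto simp: \<rho>_def split_beta' ereal_r\<close>)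
  have "plan_cost c \<sigma> < plan_cost c \<pi>"
    using less cost[OF int_\<sigma>\<rho> fin_\<sigma>] cost[OF int_\<rho>] finite by (simp add: split_beta')
  moreover have "total_cost c \<mu> \<nu> \<le> plan_cost c \<sigma>"
    unfolding total_cost_def using \<sigma> by (rule INF_lower)
  ultimately show False
    using min by simp
qed

section \<open>Potentials from cyclical monotonicity and finite chains\<close>

text \<open>Chains in \<open>G\<close> along which the cost of matching each new first coordinate with the previous second
coordinate is finite; the last argument is the total extra cost of these matchings. Infinite steps are
excluded so that totals are real numbers.\<close>

inductive chain_cost :: "('a \<Rightarrow> 'b \<Rightarrow> ereal) \<Rightarrow> ('a \<times> 'b) set \<Rightarrow> 'a \<times> 'b \<Rightarrow> 'a \<times> 'b \<Rightarrow> real \<Rightarrow> bool"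
  for c G p where
  refl: "p \<in> G \<Longrightarrow> chain_cost c G p p 0"
| step: "chain_cost c G p q t \<Longrightarrow> z \<in> G \<Longrightarrow> c (fst z) (snd q) < \<infinity> \<Longrightarrow>
    chain_cost c G p z (t + (real_of_ereal (c (fst z) (snd q)) - real_of_ereal (c (fst q) (snd q))))"

lemma chain_cost_trans:
  assumes "chain_cost c G q z s" "chain_cost c G p q t"
  shows "chain_cost c G p z (t + s)"
  using assms(1)
proof induction
  case refl
  with assms(2) show ?case by simp
next
  case (step z s w)
  from chain_cost.step[OF step.IH step.hyps(2,3)] show ?case by (simp add: add.assoc)
qed

lemma chain_cost_as_sequence:
  assumes "chain_cost c G p q t"
  shows "\<exists>n f. f 0 = p \<and> f n = q \<and> (\<forall>i\<le>n. f i \<in> G) \<and> (\<forall>i<n. c (fst (f (Suc i))) (snd (f i)) < \<infinity>) \<and>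
    t = (\<Sum>i<n. real_of_ereal (c (fst (f (Suc i))) (snd (f i))) - real_of_ereal (c (fst (f i)) (snd (f i))))"
  using assms
proof induction
  case refl
  then show ?case by (intro exI[of _ 0] exI[of _ "\<lambda>_. p"]) simp
next
  case (step q t z)
  then obtain n f where f: "f 0 = p" "f n = q" "\<forall>i\<le>n. f i \<in> G" "\<forall>i<n. c (fst (f (Suc i))) (snd (f i)) < \<infinity>"
    "t = (\<Sum>i<n. real_of_ereal (c (fst (f (Suc i))) (snd (f i))) - real_of_ereal (c (fst (f i)) (snd (f i))))"
    by blast
  show ?case
    using f step.hyps
    by (intro exI[of _ "Suc n"] exI[of _ "f(Suc n := z)"]) (auto simp: less_Suc_eq le_Suc_eq)
qed

text \<open>Rockafellar's construction. The potential is the least cost \<open>F\<close> of a chain from a base point. For a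
finite-valued cost, cyclical monotonicity suffices for \<open>F > -\<infinity>\<close>; here it is also essential that a chain
leads from the base point to each point of \<open>G\<close>, which gives \<open>F < \<infinity>\<close>, and that a chain leads back, which
closes every chain into a cycle and so bounds its cost from below. Written as an infimum over the second
coordinate of the last point, the potential is visibly a transform, of the function \<open>\<psi>\<close> below.\<close>

theorem potential_of_connected_cyclically_monotone:
  fixes c :: "'a \<Rightarrow> 'b \<Rightarrow> ereal"
  assumes c_minf: "\<And>x y. c x y \<noteq> -\<infinity>"
    and fin: "\<And>p. p \<in> G \<Longrightarrow> c (fst p) (snd p) < \<infinity>"
    and connected: "\<And>p q. p \<in> G \<Longrightarrow> q \<in> G \<Longrightarrow> \<exists>t. chain_cost c G p q t"
    and cyclic: "\<And>p t. p \<in> G \<Longrightarrow> chain_cost c G p p t \<Longrightarrow> 0 \<le> t"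
  obtains \<phi> where "\<phi> \<in> c_class c" "G \<subseteq> c_subgradient c \<phi>"
proof (cases "G = {}")
  case True
  then show thesis
    by (intro that[of "c_transform c (\<lambda>_. 0)"]) (auto simp: c_class_def)
next
  case False
  then obtain p0 where p0: "p0 \<in> G" by blast
  define r where "r p = real_of_ereal (c (fst p) (snd p))" for p
  have c_r: "c (fst p) (snd p) = ereal (r p)" if "p \<in> G" for p
    using fin[OF that] c_minf[of "fst p" "snd p"] by (cases "c (fst p) (snd p)") (auto simp: r_def)
  define S where "S p = {t. chain_cost c G p0 p t}" for p
  define F where "F p = Inf (S p)" for p
  have S_ne: "S p \<noteq> {}" if "p \<in> G" for p
    using connected[OF p0 that] by (auto simp: S_def)
  have S_bdd: "bdd_below (S p)" if "p \<in> G" for p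
  proof -
    obtain s where s: "chain_cost c G p p0 s"
      using connected[OF \<open>p \<in> G\<close> p0] by blast
    show ?thesis
    proof (rule bdd_belowI)
      fix t assume "t \<in> S p"
      then have "0 \<le> t + s"
        using cyclic[OF p0 chain_cost_trans[OF s]] by (simp add: S_def)
      then show "- s \<le> t" by simp
    qed
  qed
  define \<psi> where "\<psi> y = (SUP (q, t)\<in>{(q, t). chain_cost c G p0 q t \<and> snd q = y}. ereal (r q - t))" for y
  define \<phi> where "\<phi> = c_transform c \<psi>"
  have upper: "\<phi> x \<le> c x (snd q) - ereal (r q - t)" if "chain_cost c G p0 q t" for x q t
  proof -
    have "ereal (r q - t) \<le> \<psi> (snd q)"
      unfolding \<psi>_def using that by (intro SUP_upper2[of "(q, t)"]) auto
    then show ?thesis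
      unfolding \<phi>_def c_transform_def by (intro INF_lower2[of "snd q"] ereal_minus_mono) auto
  qed
  have lower: "ereal (F p) \<le> \<phi> (fst p)" if p: "p \<in> G" for p
    unfolding \<phi>_def c_transform_def
  proof (rule INF_greatest)
    fix y
    show "ereal (F p) \<le> c (fst p) y - \<psi> y"
    proof (cases "c (fst p) y")
      case (real s)
      have "\<psi> y \<le> ereal (s - F p)"
        unfolding \<psi>_def
      proof (rule SUP_least, clarify)
        fix a b t assume ch: "chain_cost c G p0 (a, b) t" and y: "y = snd (a, b)"
        have "chain_cost c G p0 p (t + (s - r (a, b)))"
          using chain_cost.step[OF ch p] real y by (simp add: r_def)
        then have "F p \<le> t + (s - r (a, b))"
          unfolding F_def using S_bdd[OF p] by (intro cInf_lower) (auto simp: S_def)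
        then show "ereal (r (a, b) - t) \<le> ereal (s - F p)" by simp
      qed
      then show ?thesis
        unfolding real by (cases "\<psi> y") auto
    qed (use c_minf in auto)
  qed
  \<comment> \<open>On \<open>G\<close> the transform takes the value \<open>F\<close>: each chain to \<open>p\<close> gives an upper bound, and an infimum over
    chains that end anywhere is an infimum over chains extended to \<open>p\<close>.\<close>
  have \<phi>_eq: "\<phi> (fst p) = ereal (F p)" if p: "p \<in> G" for p
  proof -
    have le: "\<phi> (fst p) \<le> ereal t" if "t \<in> S p" for t
      using upper[of p t "fst p"] that by (simp add: S_def c_r[OF p])
    then obtain f where f: "\<phi> (fst p) = ereal f"
      using lower[OF p] S_ne[OF p] by (cases "\<phi> (fst p)") auto
    have "f \<le> F p"
      unfolding F_def using S_ne[OF p] le f by (intro cInf_greatest) auto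
    with lower[OF p] f show ?thesis by simp
  qed
  have \<phi>c_eq: "c_transform' c \<phi> (snd p) = ereal (r p - F p)" if p: "p \<in> G" for p
  proof (rule antisym)
    show "c_transform' c \<phi> (snd p) \<le> ereal (r p - F p)"
      unfolding c_transform'_def by (rule INF_lower2[of "fst p"]) (simp_all add: \<phi>_eq[OF p] c_r[OF p])
    show "ereal (r p - F p) \<le> c_transform' c \<phi> (snd p)"
      unfolding c_transform'_def
    proof (rule INF_greatest)
      fix z
      show "ereal (r p - F p) \<le> c z (snd p) - \<phi> z"
      proof (cases "c z (snd p)")
        case (real s)
        have le: "\<phi> z \<le> ereal (s - r p + t)" if "t \<in> S p" for t
          using upper[of p t z] that real by (simp add: S_def algebra_simps)
        show ?thesis
        proof (cases "\<phi> z")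
          case (real f)
          have "f - s + r p \<le> F p"
            unfolding F_def
          proof (rule cInf_greatest[OF S_ne[OF p]])
            show "f - s + r p \<le> t" if "t \<in> S p" for t
              using le[OF that] real by simp
          qed
          then show ?thesis
            using real \<open>c z (snd p) = ereal s\<close> by simp
        next
          case PInf
          then show ?thesis using S_ne[OF p] le by auto
        next
          case MInf
          then show ?thesis using real by simp
        qed
      qed (use c_minf in auto)
    qed
  qed
  show thesis
  proof (rule that)
    show "\<phi> \<in> c_class c" by (simp add: \<phi>_def c_class_def)
    show "G \<subseteq> c_subgradient c \<phi>"
    proof
      fix p assume p: "p \<in> G"
      show "p \<in> c_subgradient c \<phi>"
        using \<phi>_eq[OF p] \<phi>c_eq[OF p] c_r[OF p] by (cases p) (simp add: c_subgradient_def)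
    qed
  qed
qed

section \<open>Strong compatibility makes the support connected\<close>

text \<open>The complement of the support is a union of null sets from a countable basis.\<close>

lemma AE_topological_support:
  fixes M :: "'a::second_countable_topology measure"
  assumes "finite_measure M" and sets: "sets M = sets borel"
  shows "AE z in M. z \<in> topological_support M"
proof -
  interpret finite_measure M by fact
  obtain B :: "'a set set" where B: "countable B" "topological_basis B"
    using ex_countable_basis by blast
  define N where "N = {U \<in> B. measure M U = 0}"
  have "(\<Union>U\<in>N. U) \<in> null_sets M"
  proof (rule null_sets_UN')
    show "countable N" using B(1) by (auto simp: N_def intro: countable_subset)
    show "U \<in> null_sets M" if "U \<in> N" for U
      using that topological_basis_open[OF B(2)] by (auto simp: N_def sets emeasure_eq_measure intro!: null_setsI borel_open)
  qed
  then have "AE z in M. z \<notin> (\<Union>U\<in>N. U)"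
    by (rule AE_not_in)
  then show ?thesis
  proof (rule AE_mp, intro AE_I2 impI)
    fix z assume z: "z \<notin> (\<Union>U\<in>N. U)"
    show "z \<in> topological_support M"
      unfolding topological_support_def
    proof (intro CollectI allI impI)
      fix U assume U: "open U" "z \<in> U"
      then obtain V where V: "V \<in> B" "z \<in> V" "V \<subseteq> U"
        using topological_basisE[OF B(2)] by blast
      have "0 < measure M V"
        using z V by (auto simp: N_def zero_less_measure_iff emeasure_eq_measure)
      also have "\<dots> \<le> measure M U"
        using V U by (intro finite_measure_mono) (auto simp: sets)
      finally show "0 < measure M U" .
    qed
  qed
qed

lemma continuous_cost_sections:
  fixes c :: "'a::topological_space \<Rightarrow> 'b::topological_space \<Rightarrow> ereal"
  assumes "continuous_on UNIV (\<lambda>(x, y). c x y)"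
  shows "continuous_on UNIV (\<lambda>x. c x y)" "continuous_on UNIV (\<lambda>y. c x y)"
    "continuous_on UNIV (\<lambda>z. c (fst z) (snd z))"
proof -
  show *: "continuous_on UNIV (\<lambda>z. c (fst z) (snd z))"
    using assms by (simp add: split_beta')
  show "continuous_on UNIV (\<lambda>x. c x y)"
    using continuous_on_compose2[OF *, of UNIV "\<lambda>x. (x, y)"] by (simp add: continuous_on_Pair)
  show "continuous_on UNIV (\<lambda>y. c x y)"
    using continuous_on_compose2[OF *, of UNIV "\<lambda>y. (x, y)"] by (simp add: continuous_on_Pair)
qed

text \<open>The role of strong compatibility. Let \<open>R\<close> be the set of points reachable from \<open>p\<close>, and \<open>K\<close> the set of
first coordinates at infinite cost from all second coordinates of \<open>R\<close>. Almost every point is either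
reachable or has its first coordinate in \<open>K\<close>; second coordinates of reachable points are at infinite
cost from \<open>K\<close>. So \<open>K\<close> attains equality in the compatibility inequality, which strong compatibility allows
only if \<open>\<mu> K\<close> is \<open>0\<close> or \<open>1\<close>. The complement of \<open>K\<close> is a neighbourhood of the first coordinate of the support
point \<open>p\<close>, which excludes \<open>1\<close>. Hence almost every point is reachable. Finally, the points from which \<open>q\<close>
can be reached in one step form a neighbourhood of \<open>q\<close>, which has positive mass and so contains a
reachable point.\<close>

theorem support_connected_by_finite_chains:
  fixes c :: "'a::polish_space \<Rightarrow> 'b::polish_space \<Rightarrow> ereal"
  assumes \<mu>: "prob_space \<mu>" "sets \<mu> = sets borel"
    and \<nu>: "prob_space \<nu>" "sets \<nu> = sets borel"
    and c: "continuous_on UNIV (\<lambda>(x, y). c x y)"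
    and compat: "strongly_c_compatible c \<mu> \<nu>"
    and \<pi>: "\<pi> \<in> transport_plans \<mu> \<nu>" and finite: "AE (x, y) in \<pi>. c x y < \<infinity>"
    and G: "G = topological_support \<pi> \<inter> {z. c (fst z) (snd z) < \<infinity>}"
    and p: "p \<in> G" and q: "q \<in> G"
  shows "\<exists>t. chain_cost c G p q t"
proof -
  note TD = transport_plansD[OF \<pi>]
  interpret prob_space \<pi> by (rule TD)
  interpret \<mu>: prob_space \<mu> by (rule \<mu>)
  note sec = continuous_cost_sections[OF c]
  have in_G: "AE z in \<pi>. z \<in> G"
    using AE_topological_support[OF finite_measure_axioms TD(2)] finite by (auto simp: G split_beta')
  define R where "R = {z. \<exists>t. chain_cost c G p z t}"
  have R_step: "w \<in> R" if "z \<in> R" "w \<in> G" "c (fst w) (snd z) < \<infinity>" for z w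
  proof -
    obtain t where "chain_cost c G p z t" using \<open>z \<in> R\<close> by (auto simp: R_def)
    from chain_cost.step[OF this that(2,3)] show ?thesis by (auto simp: R_def)
  qed
  have pR: "p \<in> R"
    using chain_cost.refl[OF p] by (auto simp: R_def)
  define K where "K = {x. \<forall>z\<in>R. c x (snd z) = \<infinity>}"
  define K' where "K' = {y. \<forall>x\<in>K. c x y = \<infinity>}"
  have "K = (\<Inter>z\<in>R. {x. c x (snd z) = \<infinity>})" "K' = (\<Inter>x\<in>K. {y. c x y = \<infinity>})"
    by (auto simp: K_def K'_def)
  moreover have "closed {x. c x y = \<infinity>}" "closed {y. c x y = \<infinity>}" for x y
    by (intro closed_Collect_eq sec continuous_on_const)+
  ultimately have closed: "closed K" "closed K'"
    by auto
  then have [measurable]: "K \<in> sets borel" "K' \<in> sets borel"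
    by (auto intro: borel_closed)
  have rect: "A \<times> B \<in> sets \<pi>" if "A \<in> sets borel" "B \<in> sets borel" for A B
    using that by (simp add: TD(2) borel_prod[symmetric])
  have "AE z in \<pi>. z \<in> K \<times> UNIV \<union> UNIV \<times> K'"
    using in_G
  proof (rule AE_mp, intro AE_I2 impI)
    fix z assume z: "z \<in> G"
    show "z \<in> K \<times> UNIV \<union> UNIV \<times> K'"
    proof (cases "fst z \<in> K")
      case False
      then obtain w where "w \<in> R" "c (fst z) (snd w) \<noteq> \<infinity>"
        by (auto simp: K_def)
      then have "z \<in> R"
        using z by (auto intro: R_step[of w z])
      then have "snd z \<in> K'"
        by (auto simp: K'_def K_def)
      then show ?thesis by (simp add: mem_Times_iff)
    qed (simp add: mem_Times_iff)
  qed
  then have "measure \<pi> (K \<times> UNIV \<union> UNIV \<times> K') = 1"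
    by (subst prob_eq_1) (auto intro!: rect)
  moreover have "measure \<pi> (K \<times> UNIV \<union> UNIV \<times> K') \<le> measure \<pi> (K \<times> UNIV) + measure \<pi> (UNIV \<times> K')"
    by (intro measure_Un_le rect) auto
  ultimately have ge: "1 \<le> measure \<mu> K + measure \<nu> K'"
    by (simp add: measure_plan_marginals[OF \<pi>])
  have lt: "measure \<mu> K < 1"
  proof -
    have "c (fst p) (snd p) < \<infinity>" using p by (simp add: G)
    then have "fst p \<notin> K" using pR by (auto simp: K_def)
    then have "p \<in> (- K) \<times> UNIV" by (simp add: mem_Times_iff)
    moreover have "open ((- K) \<times> (UNIV :: 'b set))"
      using closed by (intro open_Times) auto
    ultimately have "0 < measure \<pi> ((- K) \<times> UNIV)"
      using p by (simp add: G topological_support_def)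
    also have "measure \<pi> ((- K) \<times> UNIV) = measure \<mu> (space \<mu> - K)"
      using sets_eq_imp_space_eq[OF \<mu>(2)] by (simp add: measure_plan_marginals[OF \<pi>] Compl_eq_Diff_UNIV)
    also have "\<dots> = 1 - measure \<mu> K"
      by (intro \<mu>.prob_compl) (simp add: \<mu>)
    finally show ?thesis by simp
  qed
  have "measure \<mu> K = 0"
  proof (rule ccontr)
    assume "measure \<mu> K \<noteq> 0"
    then have "0 < measure \<mu> K" by (simp add: zero_less_measure_iff)
    then have "measure \<mu> K + measure \<nu> K' < 1"
      using compat lt \<mu>(2) unfolding strongly_c_compatible_def K'_def by auto
    with ge show False by simp
  qed
  then have "K \<times> UNIV \<in> null_sets \<pi>"
    by (intro null_setsI rect) (auto simp: emeasure_eq_measure measure_plan_marginals[OF \<pi>])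
  then have "AE z in \<pi>. z \<in> R"
  proof -
    assume "K \<times> UNIV \<in> null_sets \<pi>"
    from AE_not_in[OF this] in_G show ?thesis
    proof eventually_elim
      case (elim z)
      then obtain w where "w \<in> R" "c (fst z) (snd w) \<noteq> \<infinity>"
        by (auto simp: K_def mem_Times_iff)
      then show ?case
        using elim by (auto intro: R_step[of w z])
    qed
  qed
  moreover define V where "V = {z :: 'a \<times> 'b. c (fst q) (snd z) < \<infinity>}"
  have "open V"
    unfolding V_def
    by (intro open_Collect_less continuous_on_const continuous_on_compose2[OF sec(2)] continuous_on_snd continuous_on_id) auto
  moreover have "q \<in> V"
    using q by (simp add: V_def G)
  ultimately have "0 < measure \<pi> V"
    using q by (simp add: G topological_support_def)
  have "\<exists>z. z \<in> R \<and> z \<in> V"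
  proof (rule ccontr)
    assume "\<not> ?thesis"
    with \<open>AE z in \<pi>. z \<in> R\<close> have "AE z in \<pi>. z \<notin> V"
      by (auto elim: eventually_mono)
    then have "measure \<pi> V = 0"
      using \<open>open V\<close> by (subst prob_eq_0) (auto simp: TD)
    with \<open>0 < measure \<pi> V\<close> show False by simp
  qed
  then obtain z where "z \<in> R" "c (fst q) (snd z) < \<infinity>"
    by (auto simp: V_def)
  then have "q \<in> R"
    by (rule R_step[OF _ q])
  then show ?thesis by (simp add: R_def)
qed

section \<open>Optimal plans and subgradients\<close>

text \<open>Every optimal plan of finite cost is concentrated on a subgradient: its support, restricted to finite
cost, has full mass, is cyclically monotone by optimality, and is connected by strong compatibility.\<close>

theorem optimal_plan_on_subgradient:
  fixes c :: "'a::polish_space \<Rightarrow> 'b::polish_space \<Rightarrow> ereal"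
  assumes \<mu>: "prob_space \<mu>" "sets \<mu> = sets borel"
    and \<nu>: "prob_space \<nu>" "sets \<nu> = sets borel"
    and c_minf: "\<And>x y. c x y \<noteq> -\<infinity>"
    and c: "continuous_on UNIV (\<lambda>(x, y). c x y)"
    and bd: "ess_bounded_below c \<mu> \<nu>"
    and compat: "strongly_c_compatible c \<mu> \<nu>"
    and opt: "optimal_plan c \<mu> \<nu> \<pi>" and fin_cost: "plan_cost c \<pi> < \<infinity>"
  shows "\<exists>\<phi>. \<phi> \<in> c_class c \<and> concentrated_on \<pi> (c_subgradient c \<phi>)"
proof -
  have \<pi>: "\<pi> \<in> transport_plans \<mu> \<nu>" using opt by (simp add: optimal_plan_def)
  note TD = transport_plansD[OF \<pi>]
  interpret prob_space \<pi> by (rule TD)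
  obtain a b where a: "integrable \<mu> a" and b: "integrable \<nu> b" and le: "\<And>x y. ereal (a x + b y) \<le> c x y"
    using bd unfolding ess_bounded_below_def by blast
  obtain fin: "AE (x, y) in \<pi>. c x y < \<infinity>" and int: "integrable \<pi> (\<lambda>(x, y). real_of_ereal (c x y))"
    using finite_cost_integrable[OF c a b le \<pi> fin_cost] by blast
  define G where "G = topological_support \<pi> \<inter> {z. c (fst z) (snd z) < \<infinity>}"
  have "AE z in \<pi>. z \<in> G"
    using AE_topological_support[OF finite_measure_axioms TD(2)] fin by (auto simp: G_def split_beta')
  have fin_G: "c (fst z) (snd z) < \<infinity>" if "z \<in> G" for z
    using that by (simp add: G_def)
  have cyclic: "0 \<le> t" if "chain_cost c G p p t" for p t
  proof -
    obtain n f where f: "f 0 = p" "f n = p" "\<And>i. i \<le> n \<Longrightarrow> f i \<in> G"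
        "\<And>i. i < n \<Longrightarrow> c (fst (f (Suc i))) (snd (f i)) < \<infinity>"
        and t: "t = (\<Sum>i<n. real_of_ereal (c (fst (f (Suc i))) (snd (f i))) - real_of_ereal (c (fst (f i)) (snd (f i))))"
      using chain_cost_as_sequence[OF \<open>chain_cost c G p p t\<close>] by blast
    have "(\<Sum>i<n. real_of_ereal (c (fst (f i)) (snd (f i)))) \<le> (\<Sum>i<n. real_of_ereal (c (fst (f (Suc i))) (snd (f i))))"
      using f fin_G
      by (intro optimal_plan_cyclically_monotone[OF \<mu> \<nu> c c_minf opt int fin]) (auto simp: G_def)
    then show ?thesis by (simp add: t sum_subtractf)
  qed
  have connected: "\<exists>t. chain_cost c G p q t" if "p \<in> G" "q \<in> G" for p q
    by (rule support_connected_by_finite_chains[OF \<mu> \<nu> c compat \<pi> fin G_def that])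
  obtain \<phi> where "\<phi> \<in> c_class c" "G \<subseteq> c_subgradient c \<phi>"
    by (rule potential_of_connected_cyclically_monotone[OF c_minf fin_G connected cyclic])
  moreover from this(2) have "AE z in \<pi>. z \<in> c_subgradient c \<phi>"
    using \<open>AE z in \<pi>. z \<in> G\<close> by (auto elim!: eventually_mono)
  ultimately show ?thesis
    unfolding concentrated_on_def by blast
qed

theorem theorem1p1:
  fixes c :: "'a::polish_space \<Rightarrow> 'a \<Rightarrow> ereal"
    and \<mu> \<nu> :: "'a measure"
  assumes "prob_space \<mu>" and "sets \<mu> = sets borel"
    and "prob_space \<nu>" and "sets \<nu> = sets borel"
    and "\<And>x y. c x y \<noteq> -\<infinity>"
    and "continuous_on UNIV (\<lambda>(x, y). c x y)"
    and "\<And>x y. c x y = c y x"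
    and "ess_bounded_below c \<mu> \<nu>"
    and "strongly_c_compatible c \<mu> \<nu>"
    and "\<exists>\<pi> \<in> transport_plans \<mu> \<nu>. plan_cost c \<pi> < \<infinity>"
  shows "\<exists>\<phi> \<pi>. \<phi> \<in> c_class c \<and> optimal_plan c \<mu> \<nu> \<pi> \<and>
           concentrated_on \<pi> (c_subgradient c \<phi>)"
proof -
  obtain \<pi>0 where \<pi>0: "\<pi>0 \<in> transport_plans \<mu> \<nu>" "plan_cost c \<pi>0 < \<infinity>"
    using assms(10) by blast
  obtain \<pi> where opt: "optimal_plan c \<mu> \<nu> \<pi>"
    using optimal_plan_exists[OF assms(1-4,6,8)] \<pi>0(1) by blast
  have "plan_cost c \<pi> \<le> plan_cost c \<pi>0"
    using opt \<pi>0(1) by (auto simp: optimal_plan_def total_cost_def intro: INF_lower)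
  then have "plan_cost c \<pi> < \<infinity>"
    using \<pi>0(2) by (rule order_le_less_trans)
  then show ?thesis
    using optimal_plan_on_subgradient[OF assms(1-6,8,9) opt] opt by blast
qed

end
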